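(* For every $k\geq 2$ there is a Turing degree that is $k$-surviving but is not $\ell$-surviving for any $\ell\geq k+1$. Furthermore, such a degree can be chosen to be computably traceable.
   Context: A tree is a subset of $n^{<\omega}$ closed under initial segments. A $k$-branching tree is a tree in which every node has either exactly $1$ or exactly $k$ immediate successors. For $m\ge 2$, a function $f\in (m+1)^\omega$ is $m$-surviving if it is not an infinite path through any computable $m$-branching subtree of $(m+1)^{<\omega}$; a Turing degree is $m$-surviving if it computes an $m$-surviving function. A degree $\mathbf{a}$ is computably traceable if there is a computable $h:\omega\to\omega$ such that for every $f\in\omega^\omega$ computable from $\mathbf{a}$ there is a computable sequence of finite sets $(D_n)$ (given by canonical indices) with $|D_n|\leq h(n)$ and $f(n)\in D_n$ for all $n$. *)

theory Defs
  imports Main "HOL-Library.Nat_Bijection" "HOL-Library.Sublist"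
begin

section \<open>Computability relative to a function\<close>

text \<open>
  Programs for the partial recursive functions with oracle. All programs are unary; functions of
  several arguments receive them packed by \<^const>\<open>prod_encode\<close>. \<open>Query\<close> consults the oracle.
\<close>

datatype prog =
    Zero
  | Succ
  | Fst
  | Snd
  | Query
  | Pack prog prog
  | Seq prog prog
  | Prec prog prog
  | Mu prog

text \<open>
  Unbounded search: the search diverges if some value is undefined before the first zero is met.
\<close>

definition min_search :: "(nat \<Rightarrow> nat option) \<Rightarrow> nat option" where
  "min_search g =
     (if \<exists>k. g k = Some 0 \<and> (\<forall>j<k. \<exists>y. g j = Some (Suc y))
      then Some (LEAST k. g k = Some 0) else None)"

primrec run :: "(nat \<Rightarrow> nat) \<Rightarrow> prog \<Rightarrow> nat \<Rightarrow> nat option" where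
  "run A Zero = (\<lambda>x. Some 0)"
| "run A Succ = (\<lambda>x. Some (Suc x))"
| "run A Fst = (\<lambda>x. Some (fst (prod_decode x)))"
| "run A Snd = (\<lambda>x. Some (snd (prod_decode x)))"
| "run A Query = (\<lambda>x. Some (A x))"
| "run A (Pack p q) =
     (\<lambda>x. Option.bind (run A p x) (\<lambda>u. Option.bind (run A q x) (\<lambda>v. Some (prod_encode (u, v)))))"
| "run A (Seq p q) = (\<lambda>x. Option.bind (run A p x) (run A q))"
| "run A (Prec p q) =
     (\<lambda>x. rec_nat (run A p (fst (prod_decode x)))
            (\<lambda>i r. Option.bind r
               (\<lambda>y. run A q (prod_encode (fst (prod_decode x), prod_encode (i, y)))))
            (snd (prod_decode x)))"
| "run A (Mu p) = (\<lambda>x. min_search (\<lambda>k. run A p (prod_encode (x, k))))"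

definition turing_le :: "(nat \<Rightarrow> nat) \<Rightarrow> (nat \<Rightarrow> nat) \<Rightarrow> bool" (infix \<open>\<le>\<^sub>T\<close> 50) where
  "f \<le>\<^sub>T A \<longleftrightarrow> (\<exists>p. \<forall>x. run A p x = Some (f x))"

text \<open>Querying the constant zero function gives nothing beyond the program \<open>Zero\<close>.\<close>

definition computable :: "(nat \<Rightarrow> nat) \<Rightarrow> bool" where
  "computable f \<longleftrightarrow> f \<le>\<^sub>T (\<lambda>_. 0)"

primrec subst_query :: "prog \<Rightarrow> prog \<Rightarrow> prog" where
  "subst_query d Zero = Zero"
| "subst_query d Succ = Succ"
| "subst_query d Fst = Fst"
| "subst_query d Snd = Snd"
| "subst_query d Query = d"
| "subst_query d (Pack p q) = Pack (subst_query d p) (subst_query d q)"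
| "subst_query d (Seq p q) = Seq (subst_query d p) (subst_query d q)"
| "subst_query d (Prec p q) = Prec (subst_query d p) (subst_query d q)"
| "subst_query d (Mu p) = Mu (subst_query d p)"

lemma run_subst_query:
  assumes "\<And>x. run A d x = Some (B x)"
  shows "run A (subst_query d p) = run B p"
  using assms by (induction p) auto

lemma turing_le_refl: "A \<le>\<^sub>T A"
  unfolding turing_le_def by (rule exI[of _ Query]) simp

lemma turing_le_trans: "f \<le>\<^sub>T B \<Longrightarrow> B \<le>\<^sub>T A \<Longrightarrow> f \<le>\<^sub>T A"
  unfolding turing_le_def by (metis run_subst_query)

section \<open>Turing degrees\<close>

definition turing_eq :: "(nat \<Rightarrow> nat) \<Rightarrow> (nat \<Rightarrow> nat) \<Rightarrow> bool" (infix \<open>\<equiv>\<^sub>T\<close> 50) where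
  "A \<equiv>\<^sub>T B \<longleftrightarrow> A \<le>\<^sub>T B \<and> B \<le>\<^sub>T A"

quotient_type turing_degree = "nat \<Rightarrow> nat" / "(\<equiv>\<^sub>T)"
  by (rule equivpI)
    (auto simp: reflp_def symp_def transp_def turing_eq_def
       intro: turing_le_refl turing_le_trans)

lift_definition computes :: "turing_degree \<Rightarrow> (nat \<Rightarrow> nat) \<Rightarrow> bool" is "\<lambda>A f. f \<le>\<^sub>T A"
  by (auto simp: turing_eq_def fun_eq_iff intro: turing_le_trans)

section \<open>Trees and surviving functions\<close>

definition tree :: "nat \<Rightarrow> nat list set \<Rightarrow> bool" where
  "tree n T \<longleftrightarrow> T \<subseteq> lists {..<n} \<and> (\<forall>\<sigma>\<in>T. \<forall>\<tau>. prefix \<tau> \<sigma> \<longrightarrow> \<tau> \<in> T)"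

definition branching :: "nat \<Rightarrow> nat list set \<Rightarrow> bool" where
  "branching k T \<longleftrightarrow> (\<forall>\<sigma>\<in>T. card {i. \<sigma> @ [i] \<in> T} = 1 \<or> card {i. \<sigma> @ [i] \<in> T} = k)"

definition computable_strings :: "nat list set \<Rightarrow> bool" where
  "computable_strings T \<longleftrightarrow> computable (\<lambda>x. if list_decode x \<in> T then 1 else 0)"

definition path_through :: "(nat \<Rightarrow> nat) \<Rightarrow> nat list set \<Rightarrow> bool" where
  "path_through f T \<longleftrightarrow> (\<forall>n. map f [0..<n] \<in> T)"

definition surviving :: "nat \<Rightarrow> (nat \<Rightarrow> nat) \<Rightarrow> bool" where
  "surviving m f \<longleftrightarrow>
     (\<forall>n. f n < m + 1) \<and>
     \<not> (\<exists>T. tree (m + 1) T \<and> branching m T \<and> computable_strings T \<and> path_through f T)"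

definition surviving_degree :: "nat \<Rightarrow> turing_degree \<Rightarrow> bool" where
  "surviving_degree m a \<longleftrightarrow> (\<exists>f. computes a f \<and> surviving m f)"

section \<open>Computable traceability\<close>

text \<open>The canonical index of a finite set \<open>D\<close> is \<^term>\<open>set_encode D = (\<Sum>i\<in>D. 2 ^ i)\<close>.\<close>

definition computably_traceable :: "turing_degree \<Rightarrow> bool" where
  "computably_traceable a \<longleftrightarrow>
     (\<exists>h. computable h \<and>
       (\<forall>f. computes a f \<longrightarrow>
         (\<exists>D :: nat \<Rightarrow> nat set.
            (\<forall>n. finite (D n)) \<and> computable (\<lambda>n. set_encode (D n)) \<and>
            (\<forall>n. card (D n) \<le> h n \<and> f n \<in> D n))))"

end

(*
  The degree is that of a sufficiently generic path g through a sequence of computable perfect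
  (k+1)-branching trees, each contained in the previous one. A computable k-branching tree cannot contain
  all k+1 children of a node, so passing to a subtree keeps g off it. Given a program, either some
  subtree forces it to diverge, or on some subtree all its values agree and the function it computes is
  computable, or there is a subtree on which the children of every node are pairwise split. In the
  last case f(n) takes at most (k+1)^(n+1) values on the tree. Moreover at most k+1 values of f(n)
  are consistent with given f(0), ..., f(n-1): at the longest common initial segment of the
  consistent paths, splitting of the children happens at some x >= n, so each child decides f(n).
  Hence for l >= k+1 a number m(f(0), ..., f(n-1)) <= l different from f(n) can be computed, and
  deleting this one child at every node gives an l-branching tree with path f.
*)
theory Submission
  imports Defs "HOL-Library.Countable" "HOL-Library.More_List"
begin

section \<open>Recursive functions on coded types\<close>

text \<open>The number \<open>k + 1\<close> does two jobs: it is one more than a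
  \<open>k\<close>-branching tree allows, and it bounds the possible next values of a reduction,
  which leaves one of the \<open>l + 1\<close> candidates free as soon as
  \<open>l \<ge> k + 1\<close>. For this bound all pairs of children have to be split, not just two
  of them: any two children that both remain possible must differ at an argument that has not been
  revealed yet. Traceability further asks for one bound for all functions, so splitting at depth
  \<open>n\<close> is made to decide argument \<open>n\<close> as well.

  Trees are given by recursive maps from index strings to branching nodes, so that passing to a
  subtree is composition. Which case holds for a program is settled noneffectively, but in each case
  the required function or subtree must be recursive; it is found by unbounded search, whose success
  the case itself guarantees. The requirements are countable in number because each program is read
  in two ways, as a decision procedure for a tree and as a reduction.\<close>

class coded =
  fixes encode :: "'a \<Rightarrow> nat" and decode :: "nat \<Rightarrow> 'a"
  assumes decode_encode [simp]: "decode (encode x) = x"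
    and encode_decode [simp]: "encode (decode n) = n"

lemma encode_eq_iff: "encode x = encode y \<longleftrightarrow> x = y"
  by (metis decode_encode)

instantiation nat :: coded
begin

definition "encode (n::nat) = n"

definition "decode n = (n::nat)"

instance
  by standard (simp_all add: encode_nat_def decode_nat_def)

end

instantiation prod :: (coded, coded) coded
begin

definition "encode z = prod_encode (map_prod encode encode z)"

definition "decode n = map_prod decode decode (prod_decode n)"

instance
  by standard (simp_all add: encode_prod_def decode_prod_def map_prod.compositionality o_def
      map_prod.identity[unfolded id_def])

end

instantiation option :: (coded) coded
begin

definition "encode z = (case z of None \<Rightarrow> 0 | Some x \<Rightarrow> Suc (encode x))"

definition "decode n = (case n of 0 \<Rightarrow> None | Suc m \<Rightarrow> Some (decode m))"

instance
  by standard (simp_all add: encode_option_def decode_option_def split: option.split nat.split)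

end

instantiation list :: (coded) coded
begin

definition "encode xs = list_encode (map encode xs)"

definition "decode n = map decode (list_decode n)"

instance
  by standard (simp_all add: encode_list_def decode_list_def o_def)

end

text \<open>Codes of different types are aligned: \<open>Some\<close> acts as the successor, and
  \<open>x # xs\<close> has the same code as \<open>Some (x, xs)\<close>. Case analysis on lists
  thus reduces to case analysis on options.\<close>

lemma encode_simps:
  "encode (a, b) = prod_encode (encode a, encode b)"
  "encode (None :: 'a::coded option) = 0"
  "encode (Some a) = Suc (encode a)"
  "encode ([] :: 'a::coded list) = 0"
  "encode (a # as) = Suc (prod_encode (encode a, encode as))"
  "encode (n::nat) = n"
  by (simp_all add: encode_prod_def encode_option_def encode_list_def encode_nat_def)

definition recursive :: "('a::coded \<Rightarrow> 'b::coded) \<Rightarrow> bool" where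
  "recursive f \<longleftrightarrow> computable (\<lambda>n. encode (f (decode n)))"

lemma recursive_iff:
  "recursive f \<longleftrightarrow> (\<exists>p. \<forall>x. run (\<lambda>_. 0) p (encode x) = Some (encode (f x)))"
proof -
  have "(\<forall>x. run (\<lambda>_. 0) p (encode x) = Some (encode (f x))) \<longleftrightarrow>
      (\<forall>n. run (\<lambda>_. 0) p n = Some (encode (f (decode n))))" for p
  proof (intro iffI allI)
    fix n assume "\<forall>x. run (\<lambda>_. 0) p (encode x) = Some (encode (f x))"
    from this[rule_format, of "decode n"] show "run (\<lambda>_. 0) p n = Some (encode (f (decode n)))"
      by simp
  qed simp
  then show ?thesis
    unfolding recursive_def computable_def turing_le_def by simp
qed

lemma recursive_nat: "recursive (f :: nat \<Rightarrow> nat) \<longleftrightarrow> computable f"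
  by (simp add: recursive_def encode_nat_def decode_nat_def)

named_theorems recursive_intros

text \<open>Coercions between types with matching codes are the identity on numbers, and
  \<open>Pack Fst Snd\<close> is an identity program because every number codes a pair.\<close>

lemma recursive_by_code: "(\<And>x. encode (f x) = encode x) \<Longrightarrow> recursive f"
  unfolding recursive_iff
  by (rule exI[of _ "Pack Fst Snd"]) simp

lemma recursive_app:
  assumes "recursive h" "recursive f"
  shows "recursive (\<lambda>x. h (f x))"
proof -
  obtain p q where "\<forall>x. run (\<lambda>_. 0) p (encode x) = Some (encode (h x))"
    "\<forall>x. run (\<lambda>_. 0) q (encode x) = Some (encode (f x))"
    using assms unfolding recursive_iff by blast
  then have "\<forall>x. run (\<lambda>_. 0) (Seq q p) (encode x) = Some (encode (h (f x)))"
    by simp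
  then show ?thesis
    unfolding recursive_iff by blast
qed

lemma recursive_id [recursive_intros]: "recursive (\<lambda>x. x)"
  by (rule recursive_by_code) simp

lemma recursive_const [recursive_intros]: "recursive (\<lambda>_. c)"
proof -
  have "\<exists>p. \<forall>x. run (\<lambda>_. 0) p x = Some n" for n
  proof (induction n)
    case 0
    then show ?case by (intro exI[of _ Zero]) simp
  next
    case (Suc n)
    then obtain p where "\<forall>x. run (\<lambda>_. 0) p x = Some n" by blast
    then show ?case by (intro exI[of _ "Seq p Succ"]) simp
  qed
  then show ?thesis unfolding recursive_iff by blast
qed

lemma recursive_fst [recursive_intros]:
  assumes "recursive f" shows "recursive (\<lambda>x. fst (f x))"
proof (rule recursive_app[OF _ assms])
  show "recursive (fst :: 'b \<times> 'c \<Rightarrow> 'b)"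
    unfolding recursive_iff by (rule exI[of _ Fst]) (auto simp: encode_simps)
qed

lemma recursive_snd [recursive_intros]:
  assumes "recursive f" shows "recursive (\<lambda>x. snd (f x))"
proof (rule recursive_app[OF _ assms])
  show "recursive (snd :: 'b \<times> 'c \<Rightarrow> 'c)"
    unfolding recursive_iff by (rule exI[of _ Snd]) (auto simp: encode_simps)
qed

lemma recursive_Suc [recursive_intros]:
  assumes "recursive f" shows "recursive (\<lambda>x. Suc (f x))"
proof (rule recursive_app[OF _ assms])
  show "recursive Suc"
    unfolding recursive_iff by (rule exI[of _ Succ]) (auto simp: encode_simps)
qed

lemma recursive_Pair [recursive_intros]:
  assumes "recursive f" "recursive g"
  shows "recursive (\<lambda>x. (f x, g x))"
proof -
  obtain p q where "\<forall>x. run (\<lambda>_. 0) p (encode x) = Some (encode (f x))"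
    "\<forall>x. run (\<lambda>_. 0) q (encode x) = Some (encode (g x))"
    using assms unfolding recursive_iff by blast
  then have "\<forall>x. run (\<lambda>_. 0) (Pack p q) (encode x) = Some (encode (f x, g x))"
    by (simp add: encode_simps)
  then show ?thesis
    unfolding recursive_iff by blast
qed

lemma recursive_rec_nat [recursive_intros]:
  fixes s :: "'a::coded \<Rightarrow> nat \<Rightarrow> 'b::coded \<Rightarrow> 'b"
  assumes "recursive (\<lambda>z. s (fst z) (fst (snd z)) (snd (snd z)))" "recursive b" "recursive n"
  shows "recursive (\<lambda>x. rec_nat (b x) (s x) (n x))"
proof -
  obtain p q where p: "\<And>x. run (\<lambda>_. 0) p (encode x) = Some (encode (b x))"
    and q: "\<And>z. run (\<lambda>_. 0) q (encode z) = Some (encode (s (fst z) (fst (snd z)) (snd (snd z))))"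
    using assms(1,2) unfolding recursive_iff by blast
  have "run (\<lambda>_. 0) (Prec p q) (encode (x, m)) = Some (encode (rec_nat (b x) (s x) m))" for x m
  proof (induction m)
    case 0
    then show ?case by (simp add: encode_simps p)
  next
    case (Suc m)
    then show ?case using q[of "(x, m, rec_nat (b x) (s x) m)"] by (simp add: encode_simps)
  qed
  then have "recursive (\<lambda>z. rec_nat (b (fst z)) (s (fst z)) (snd z))"
    unfolding recursive_iff by (intro exI[of _ "Prec p q"]) auto
  from recursive_app[OF this recursive_Pair[OF recursive_id assms(3)]] show ?thesis
    by simp
qed

lemma recursive_case_option [recursive_intros]:
  fixes g :: "'a::coded \<Rightarrow> 'c::coded \<Rightarrow> 'b::coded"
  assumes "recursive (\<lambda>z. g (fst z) (snd z))" "recursive b" "recursive f"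
  shows "recursive (\<lambda>x. case f x of None \<Rightarrow> b x | Some y \<Rightarrow> g x y)"
proof -
  have dec: "recursive (decode :: nat \<Rightarrow> 'c)"
    by (rule recursive_by_code) (simp add: encode_simps)
  have enc: "recursive (encode :: 'c option \<Rightarrow> nat)"
    by (rule recursive_by_code) (simp add: encode_simps)
  have arg: "recursive (\<lambda>z :: 'a \<times> nat \<times> 'b. (fst z, decode (fst (snd z)) :: 'c))"
    by (intro recursive_Pair recursive_fst recursive_snd recursive_id recursive_app[OF dec])
  have "recursive (\<lambda>z :: 'a \<times> nat \<times> 'b. g (fst z) (decode (fst (snd z))))"
    using recursive_app[OF assms(1) arg] by simp
  \<comment> \<open>\<open>None\<close> has code 0 and \<open>Some y\<close> a successor, so this
    recursion ignores its accumulator and uses only the last index \<open>i\<close>, which is the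
    code of \<open>y\<close>.\<close>
  then have "recursive (\<lambda>x. rec_nat (b x) (\<lambda>i _. g x (decode i)) (encode (f x)))"
    using assms(2) by (rule recursive_rec_nat) (rule recursive_app[OF enc assms(3)])
  then show ?thesis
    by (rule back_subst[of recursive]) (auto simp: encode_simps split: option.split)
qed

lemma recursive_Some [recursive_intros]:
  assumes "recursive f" shows "recursive (\<lambda>x. Some (f x))"
proof (rule recursive_app[OF _ assms])
  show "recursive (Some :: 'b \<Rightarrow> 'b option)"
    unfolding recursive_iff by (rule exI[of _ Succ]) (auto simp: encode_simps)
qed

lemma recursive_bind [recursive_intros]:
  assumes "recursive (\<lambda>z. g (fst z) (snd z))" "recursive f"
  shows "recursive (\<lambda>x. Option.bind (f x) (g x))"
proof -
  have "recursive (\<lambda>x. case f x of None \<Rightarrow> None | Some y \<Rightarrow> g x y)"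
    using assms by (intro recursive_intros)
  then show ?thesis
    by (rule back_subst[of recursive]) (auto split: option.split)
qed

section \<open>Decidable predicates, arithmetic and unbounded search\<close>

text \<open>A bijective code exists for infinite types only, so \<open>bool\<close> has none and
  predicates enter through their characteristic functions.\<close>

definition decidable :: "('a::coded \<Rightarrow> bool) \<Rightarrow> bool" where
  "decidable P \<longleftrightarrow> recursive (\<lambda>x. if P x then 1 else 0 :: nat)"

lemma decidable_app:
  assumes "decidable P" "recursive f"
  shows "decidable (\<lambda>x. P (f x))"
  using recursive_app[OF assms(1)[unfolded decidable_def] assms(2)] unfolding decidable_def .

lemma recursive_pred [recursive_intros]:
  assumes "recursive f" shows "recursive (\<lambda>x. f x - Suc 0)"
proof -
  have "recursive (\<lambda>x. rec_nat 0 (\<lambda>i _. i) (f x))"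
    using assms by (intro recursive_intros)
  moreover have "rec_nat 0 (\<lambda>i _. i) n = n - Suc 0" for n
    by (cases n) auto
  ultimately show ?thesis by simp
qed

lemma recursive_diff [recursive_intros]:
  assumes "recursive f" "recursive g" shows "recursive (\<lambda>x. f x - g x :: nat)"
proof -
  have "recursive (\<lambda>x. rec_nat (f x) (\<lambda>_ r. r - Suc 0) (g x))"
    using assms by (intro recursive_intros)
  moreover have "rec_nat m (\<lambda>_ r. r - Suc 0) n = m - n" for m n
    by (induction n) auto
  ultimately show ?thesis by simp
qed

lemma recursive_add [recursive_intros]:
  assumes "recursive f" "recursive g" shows "recursive (\<lambda>x. f x + g x :: nat)"
proof -
  have "recursive (\<lambda>x. rec_nat (f x) (\<lambda>_ r. Suc r) (g x))"
    using assms by (intro recursive_intros)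
  moreover have "rec_nat m (\<lambda>_ r. Suc r) n = m + n" for m n
    by (induction n) auto
  ultimately show ?thesis by simp
qed

lemma recursive_mult [recursive_intros]:
  assumes "recursive f" "recursive g" shows "recursive (\<lambda>x. f x * g x :: nat)"
proof -
  have "recursive (\<lambda>x. rec_nat 0 (\<lambda>_ r. f x + r) (g x))"
    using assms recursive_app[OF assms(1) recursive_fst[OF recursive_id]]
    by (intro recursive_intros)
  moreover have "rec_nat 0 (\<lambda>_ r. m + r) n = m * n" for m n :: nat
    by (induction n) auto
  ultimately show ?thesis by simp
qed

lemma recursive_power [recursive_intros]:
  assumes "recursive f" "recursive g" shows "recursive (\<lambda>x. f x ^ g x :: nat)"
proof -
  have "recursive (\<lambda>x. rec_nat 1 (\<lambda>_ r. f x * r) (g x))"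
    using assms recursive_app[OF assms(1) recursive_fst[OF recursive_id]]
    by (intro recursive_intros)
  moreover have "rec_nat 1 (\<lambda>_ r. m * r) n = m ^ n" for m n :: nat
    by (induction n) auto
  ultimately show ?thesis by simp
qed

lemma recursive_if [recursive_intros]:
  assumes "decidable P" "recursive f" "recursive g"
  shows "recursive (\<lambda>x. if P x then f x else g x)"
proof -
  have "recursive (\<lambda>x. rec_nat (g x) (\<lambda>_ _. f x) (if P x then 1 else 0 :: nat))"
    using assms recursive_app[OF assms(2) recursive_fst[OF recursive_id]]
    unfolding decidable_def by (intro recursive_intros)
  then show ?thesis
    by (rule back_subst[of recursive]) auto
qed

lemma decidable_not [recursive_intros]:
  assumes "decidable P" shows "decidable (\<lambda>x. \<not> P x)"
proof -
  have "recursive (\<lambda>x. if P x then 0 else 1 :: nat)"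
    using assms by (intro recursive_intros)
  then show ?thesis
    unfolding decidable_def by (rule back_subst[of recursive]) auto
qed

lemma decidable_conj [recursive_intros]:
  assumes "decidable P" "decidable Q" shows "decidable (\<lambda>x. P x \<and> Q x)"
proof -
  have "recursive (\<lambda>x. if P x then if Q x then 1 else 0 else 0 :: nat)"
    using assms by (intro recursive_intros)
  then show ?thesis
    unfolding decidable_def by (rule back_subst[of recursive]) auto
qed

lemma decidable_disj [recursive_intros]:
  assumes "decidable P" "decidable Q" shows "decidable (\<lambda>x. P x \<or> Q x)"
  using decidable_not[OF decidable_conj[OF decidable_not[OF assms(1)] decidable_not[OF assms(2)]]]
  by simp

lemma decidable_imp [recursive_intros]:
  assumes "decidable P" "decidable Q" shows "decidable (\<lambda>x. P x \<longrightarrow> Q x)"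
  unfolding imp_conv_disj using assms by (intro recursive_intros)

lemma decidable_less [recursive_intros]:
  assumes "recursive f" "recursive g" shows "decidable (\<lambda>x. f x < (g x :: nat))"
proof -
  have "recursive (\<lambda>x. rec_nat 0 (\<lambda>_ _. 1) (g x - f x) :: nat)"
    using assms by (intro recursive_intros)
  moreover have "rec_nat 0 (\<lambda>_ _. 1) (n - m) = (if m < n then 1 else 0 :: nat)" for m n :: nat
    by (cases "n - m") auto
  ultimately show ?thesis
    unfolding decidable_def by simp
qed

lemma decidable_le [recursive_intros]:
  assumes "recursive f" "recursive g" shows "decidable (\<lambda>x. f x \<le> (g x :: nat))"
  using decidable_not[OF decidable_less[OF assms(2,1)]] by (simp add: not_less)

lemma decidable_eq [recursive_intros]:
  assumes "recursive f" "recursive g" shows "decidable (\<lambda>x. f x = g x)"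
proof -
  have code: "recursive (encode :: 'b \<Rightarrow> nat)"
    by (rule recursive_by_code) (simp add: encode_simps)
  have "decidable (\<lambda>x. encode (f x) \<le> encode (g x) \<and> encode (g x) \<le> encode (f x))"
    using assms by (intro recursive_intros recursive_app[OF code])
  moreover have "encode u \<le> encode v \<and> encode v \<le> encode u \<longleftrightarrow> u = v" for u v :: 'b
    by (metis encode_eq_iff order_antisym order_refl)
  ultimately show ?thesis by simp
qed

lemma recursive_Least [recursive_intros]:
  fixes P :: "'a::coded \<Rightarrow> nat \<Rightarrow> bool"
  assumes "decidable (\<lambda>z. P (fst z) (snd z))" "\<And>x. \<exists>n. P x n"
  shows "recursive (\<lambda>x. LEAST n. P x n)"
proof -
  have "recursive (\<lambda>z. if P (fst z) (snd z) then 0 else 1 :: nat)"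
    using assms(1) by (intro recursive_intros)
  then obtain p where
    p: "\<And>z. run (\<lambda>_. 0) p (encode z) = Some (if P (fst z) (snd z) then 0 else 1)"
    unfolding recursive_iff encode_simps(6) by blast
  have run: "run (\<lambda>_. 0) p (prod_encode (encode x, n)) = Some (if P x n then 0 else 1)" for x n
    using p[of "(x, n)"] by (simp add: encode_simps)
  have "run (\<lambda>_. 0) (Mu p) (encode x) = Some (LEAST n. P x n)" for x
  proof -
    define m where "m = (LEAST n. P x n)"
    have "P x m" "\<forall>j<m. \<not> P x j"
      using assms(2)[of x] not_less_Least unfolding m_def by (auto intro: LeastI_ex)
    then have "\<exists>k. (if P x k then 0 else 1 :: nat) = 0 \<and>
        (\<forall>j<k. \<exists>y. (if P x j then 0 else 1) = Suc y)"
      by (intro exI[of _ m]) auto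
    then show ?thesis
      by (auto simp: min_search_def run)
  qed
  then show ?thesis
    unfolding recursive_iff by (intro exI[of _ "Mu p"]) (simp add: encode_simps)
qed

lemma decidable_all_less [recursive_intros]:
  fixes P :: "'a::coded \<Rightarrow> nat \<Rightarrow> bool"
  assumes "decidable (\<lambda>z. P (fst z) (snd z))" "recursive f"
  shows "decidable (\<lambda>x. \<forall>i<f x. P x i)"
proof -
  \<comment> \<open>The bound itself counts as a hit, so the search always ends; it ends before
    \<open>f x\<close> exactly when there is a counterexample.\<close>
  have "decidable (\<lambda>x. f x \<le> (LEAST n. f x \<le> n \<or> \<not> P x n))"
    using assms recursive_app[OF assms(2) recursive_fst[OF recursive_id]]
    by (intro recursive_intros) auto
  moreover have "f x \<le> (LEAST n. f x \<le> n \<or> \<not> P x n) \<longleftrightarrow> (\<forall>i<f x. P x i)" for x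
  proof -
    have "f x \<le> (LEAST n. f x \<le> n \<or> \<not> P x n) \<or> \<not> P x (LEAST n. f x \<le> n \<or> \<not> P x n)"
      by (rule LeastI[of _ "f x"]) simp
    then show ?thesis
      using not_less_Least[of _ "\<lambda>n. f x \<le> n \<or> \<not> P x n"] by (meson le_less_trans less_le_trans not_less)
  qed
  ultimately show ?thesis by simp
qed

lemma decidable_ex_less [recursive_intros]:
  fixes P :: "'a::coded \<Rightarrow> nat \<Rightarrow> bool"
  assumes "decidable (\<lambda>z. P (fst z) (snd z))" "recursive f"
  shows "decidable (\<lambda>x. \<exists>i<f x. P x i)"
  using decidable_not[OF decidable_all_less[OF decidable_not[OF assms(1)] assms(2)]] by simp

section \<open>Recursive operations on lists\<close>

lemma recursive_case_list [recursive_intros]: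
  fixes g :: "'a::coded \<Rightarrow> 'c::coded \<Rightarrow> 'c list \<Rightarrow> 'b::coded"
  assumes "recursive (\<lambda>z. g (fst z) (fst (snd z)) (snd (snd z)))" "recursive b" "recursive f"
  shows "recursive (\<lambda>x. case f x of [] \<Rightarrow> b x | y # ys \<Rightarrow> g x y ys)"
proof -
  have split: "recursive (\<lambda>xs :: 'c list. case xs of [] \<Rightarrow> None | y # ys \<Rightarrow> Some (y, ys))"
    by (rule recursive_by_code) (simp add: encode_simps split: list.split)
  have "recursive (\<lambda>x. case (case f x of [] \<Rightarrow> None | y # ys \<Rightarrow> Some (y, ys)) of
      None \<Rightarrow> b x | Some z \<Rightarrow> g x (fst z) (snd z))"
    by (intro recursive_case_option assms recursive_app[OF split])
  then show ?thesis
    by (rule back_subst[of recursive]) (auto split: list.split)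
qed

lemma recursive_Cons [recursive_intros]:
  assumes "recursive f" "recursive g" shows "recursive (\<lambda>x. f x # g x)"
proof -
  have "recursive (\<lambda>z :: 'b \<times> 'b list. fst z # snd z)"
    unfolding recursive_iff by (rule exI[of _ "Seq (Pack Fst Snd) Succ"]) (auto simp: encode_simps)
  from recursive_app[OF this recursive_Pair[OF assms]] show ?thesis
    by simp
qed

lemma length_le_encode: "length xs \<le> encode xs"
proof (induction xs)
  case (Cons x xs)
  then show ?case
    using le_prod_encode_2[of "encode xs" "encode x"] by (simp add: encode_simps)
qed (simp add: encode_simps)

text \<open>The fold becomes an iteration that removes one list element per round and stands still
  at the empty list. Any bound on the length can serve as the number of rounds, and the code of the
  list is such a bound.\<close>

lemma recursive_foldl [recursive_intros]:
  fixes s :: "'a::coded \<Rightarrow> 'b::coded \<Rightarrow> 'c::coded \<Rightarrow> 'b"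
  assumes "recursive (\<lambda>z. s (fst z) (fst (snd z)) (snd (snd z)))" "recursive b" "recursive f"
  shows "recursive (\<lambda>x. foldl (s x) (b x) (f x))"
proof -
  define step where
    "step x z = (case snd z of [] \<Rightarrow> z | y # ys \<Rightarrow> (s x (fst z) y, ys))" for x and z :: "'b \<times> 'c list"
  have enc: "recursive (encode :: 'c list \<Rightarrow> nat)"
    by (rule recursive_by_code) (simp add: encode_simps)
  have *: "fst (rec_nat (c, ys) (\<lambda>_. step x) n) = foldl (s x) c ys" if "length ys \<le> n" for x c ys n
  proof -
    have "(step x ^^ n) (c, ys) = (foldl (s x) c ys, [])"
      using that by (induction n arbitrary: c ys) (auto simp: step_def funpow_swap1 simp del: funpow.simps(2)
         simp add: funpow_Suc_right split: list.split)
    moreover have "rec_nat (c, ys) (\<lambda>_. step x) n = (step x ^^ n) (c, ys)"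
      by (induction n) auto
    ultimately show ?thesis by simp
  qed
  have arg: "recursive (\<lambda>z :: ('a \<times> nat \<times> 'b \<times> 'c list) \<times> 'c \<times> 'c list.
      (fst (fst z), fst (snd (snd (fst z))), fst (snd z)))"
    by (intro recursive_intros)
  have "recursive (\<lambda>z :: 'a \<times> nat \<times> 'b \<times> 'c list. step (fst z) (snd (snd z)))"
    unfolding step_def using recursive_app[OF assms(1) arg]
    by (intro recursive_intros) simp_all
  then have "recursive (\<lambda>x. fst (rec_nat (b x, f x) (\<lambda>_. step x) (encode (f x))))"
    by (intro recursive_intros recursive_app[OF enc] assms)
  then show ?thesis
    by (simp add: * length_le_encode)
qed

lemma recursive_rev [recursive_intros]:
  assumes "recursive f" shows "recursive (\<lambda>x. rev (f x))"
proof -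
  have "recursive (\<lambda>x. foldl (\<lambda>a y. y # a) [] (f x))"
    using assms by (intro recursive_intros)
  moreover have "foldl (\<lambda>a y. y # a) c ys = rev ys @ c" for c ys :: "'b list"
    by (induction ys arbitrary: c) auto
  ultimately show ?thesis by simp
qed

lemma recursive_append [recursive_intros]:
  assumes "recursive f" "recursive g" shows "recursive (\<lambda>x. f x @ g x)"
proof -
  have "recursive (\<lambda>x. foldl (\<lambda>a y. y # a) (g x) (rev (f x)))"
    using assms by (intro recursive_intros)
  moreover have "foldl (\<lambda>a y. y # a) c ys = rev ys @ c" for c ys :: "'b list"
    by (induction ys arbitrary: c) auto
  ultimately show ?thesis by simp
qed

lemma recursive_length [recursive_intros]:
  assumes "recursive f" shows "recursive (\<lambda>x. length (f x))"
proof -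
  have "recursive (\<lambda>x. foldl (\<lambda>a y. Suc a) 0 (f x))"
    using assms by (intro recursive_intros)
  moreover have "foldl (\<lambda>a y. Suc a) c ys = length ys + c" for c and ys :: "'b list"
    by (induction ys arbitrary: c) auto
  ultimately show ?thesis by simp
qed

lemma recursive_nth_default [recursive_intros]:
  assumes "recursive f" "recursive g" shows "recursive (\<lambda>x. nth_default d (f x) (g x))"
proof -
  have "recursive (\<lambda>x. case rec_nat (f x) (\<lambda>_ ys. case ys of [] \<Rightarrow> [] | _ # ys \<Rightarrow> ys) (g x) of
      [] \<Rightarrow> d | y # _ \<Rightarrow> y)"
    using assms by (intro recursive_intros)
  moreover have "rec_nat xs (\<lambda>_ ys. case ys of [] \<Rightarrow> [] | _ # ys \<Rightarrow> ys) n = drop n xs"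
    for n and xs :: "'b list"
  proof (induction n)
    case (Suc n)
    then show ?case
      by (simp add: drop_Suc flip: tl_drop) (simp split: list.split)
  qed simp
  moreover have "(case drop n xs of [] \<Rightarrow> d | y # _ \<Rightarrow> y) = nth_default d xs n" for n xs
    by (cases "n < length xs") (simp_all add: nth_default_def Cons_nth_drop_Suc[symmetric])
  ultimately show ?thesis by simp
qed

lemma recursive_map [recursive_intros]:
  fixes h :: "'a::coded \<Rightarrow> 'c::coded \<Rightarrow> 'b::coded"
  assumes "recursive (\<lambda>z. h (fst z) (snd z))" "recursive f"
  shows "recursive (\<lambda>x. map (h x) (f x))"
proof -
  have arg: "recursive (\<lambda>z :: 'a \<times> 'b list \<times> 'c. (fst z, snd (snd z)))"
    by (intro recursive_intros)
  have "recursive (\<lambda>x. foldl (\<lambda>a y. a @ [h x y]) [] (f x))"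
    using recursive_app[OF assms(1) arg] assms(2) by (intro recursive_intros) simp_all
  moreover have "foldl (\<lambda>a y. a @ [h x y]) c ys = c @ map (h x) ys" for c x ys
    by (induction ys arbitrary: c) auto
  ultimately show ?thesis by simp
qed

lemma recursive_concat [recursive_intros]:
  assumes "recursive f" shows "recursive (\<lambda>x. concat (f x))"
proof -
  have "recursive (\<lambda>x. foldl (@) [] (f x))"
    using assms by (intro recursive_intros)
  moreover have "foldl (@) c xss = c @ concat xss" for c and xss :: "'b list list"
    by (induction xss arbitrary: c) auto
  ultimately show ?thesis by simp
qed

lemma recursive_upt [recursive_intros]:
  assumes "recursive f" shows "recursive (\<lambda>x. [0..<f x])"
proof -
  have "recursive (\<lambda>x. rec_nat [] (\<lambda>i r. r @ [i]) (f x))"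
    using assms by (intro recursive_intros)
  moreover have "rec_nat [] (\<lambda>i r. r @ [i]) n = [0..<n]" for n
    by (induction n) auto
  ultimately show ?thesis by simp
qed

lemma recursive_n_lists [recursive_intros]:
  assumes "recursive f" shows "recursive (\<lambda>x. List.n_lists (f x) xs)"
proof -
  have "recursive (\<lambda>x. rec_nat [[]] (\<lambda>_ r. concat (map (\<lambda>ys. map (\<lambda>y. y # ys) xs) r)) (f x))"
    using assms by (intro recursive_intros)
  moreover have "rec_nat [[]] (\<lambda>_ r. concat (map (\<lambda>ys. map (\<lambda>y. y # ys) xs) r)) n = List.n_lists n xs" for n
    by (induction n) auto
  ultimately show ?thesis by simp
qed

lemma decidable_Ball_list [recursive_intros]:
  fixes P :: "'a::coded \<Rightarrow> 'b::coded \<Rightarrow> bool"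
  assumes "decidable (\<lambda>z. P (fst z) (snd z))" "recursive f"
  shows "decidable (\<lambda>x. \<forall>y\<in>set (f x). P x y)"
proof -
  have arg: "recursive (\<lambda>z :: 'a \<times> nat \<times> 'b. (fst z, snd (snd z)))"
    by (intro recursive_intros)
  have "recursive (\<lambda>x. foldl (\<lambda>a y. if P x y then a else 0) (Suc 0) (f x))"
    using decidable_app[OF assms(1) arg] assms(2) by (intro recursive_intros) simp_all
  moreover have "foldl (\<lambda>a y. if P x y then a else 0) c ys = (if \<forall>y\<in>set ys. P x y then c else 0 :: nat)"
    for c x ys
    by (induction ys arbitrary: c) auto
  ultimately show ?thesis
    unfolding decidable_def One_nat_def by simp
qed

lemma recursive_div [recursive_intros]:
  assumes "recursive f" "recursive g" shows "recursive (\<lambda>x. f x div g x :: nat)"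
proof -
  have "\<exists>q. n = 0 \<or> m < Suc q * n" for m n :: nat
    by (rule exI[of _ m], cases n) auto
  \<comment> \<open>For a zero divisor the first disjunct ends the search at 0, which is the value
    of \<open>div\<close> there.\<close>
  then have "recursive (\<lambda>x. LEAST q. g x = 0 \<or> f x < Suc q * g x)"
    using recursive_app[OF assms(1) recursive_fst[OF recursive_id]]
      recursive_app[OF assms(2) recursive_fst[OF recursive_id]]
    by (intro recursive_intros) simp_all
  moreover have "(LEAST q. n = 0 \<or> m < Suc q * n) = m div n" for m n :: nat
  proof (cases "n = 0")
    case False
    then show ?thesis
      by (intro Least_equality)
        (auto simp: dividend_less_times_div less_Suc_eq_le[symmetric] less_mult_imp_div_less
          dividend_less_div_times add.commute)
  qed (auto intro: Least_equality)
  ultimately show ?thesis by simp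
qed

lemma decidable_odd [recursive_intros]:
  assumes "recursive f" shows "decidable (\<lambda>x. odd (f x :: nat))"
proof -
  have "decidable (\<lambda>x. \<not> f x = 2 * (f x div 2))"
    using assms by (intro recursive_intros)
  moreover have "n = 2 * (n div 2) \<longleftrightarrow> even n" for n :: nat
    by (metis dvd_mult_div_cancel dvd_triv_left)
  ultimately show ?thesis by simp
qed

lemma recursive_set_encode [recursive_intros]:
  assumes "recursive f" shows "recursive (\<lambda>x. set_encode (set (f x)))"
proof -
  \<comment> \<open>An odd \<open>c div 2 ^ v\<close> means that \<open>v\<close> is already in the
    set coded by \<open>c\<close>; the test keeps repeated list elements from being added
    twice.\<close>
  have "recursive (\<lambda>x. foldl (\<lambda>c v. if odd (c div 2 ^ v) then c else 2 ^ v + c :: nat) 0 (f x))"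
    using assms by (intro recursive_intros)
  moreover have "foldl (\<lambda>c v. if odd (c div 2 ^ v) then c else 2 ^ v + c) (set_encode A) vs =
      set_encode (A \<union> set vs)" if "finite A" for A vs
    using that
  proof (induction vs arbitrary: A)
    case (Cons v vs)
    have "odd (set_encode A div 2 ^ v) \<longleftrightarrow> v \<in> A"
      using set_encode_inverse[OF Cons.prems] unfolding set_decode_def by blast
    then have "(if odd (set_encode A div 2 ^ v) then set_encode A else 2 ^ v + set_encode A) =
        set_encode (insert v A)"
      using Cons.prems by (simp add: set_encode_insert insert_absorb)
    then show ?case
      using Cons.IH[of "insert v A"] Cons.prems by simp
  qed simp
  from this[of "{}"] have "foldl (\<lambda>c v. if odd (c div 2 ^ v) then c else 2 ^ v + c) 0 vs =
      set_encode (set vs)" for vs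
    by simp
  ultimately show ?thesis by simp
qed

section \<open>Computations with finitely many oracle values\<close>

abbreviation restrict :: "(nat \<Rightarrow> nat) \<Rightarrow> nat \<Rightarrow> nat list" (infixl \<open>\<restriction>\<close> 100) where
  "g \<restriction> n \<equiv> map g [0..<n]"

lemma restrict_prefix: "m \<le> n \<Longrightarrow> prefix (g \<restriction> m) (g \<restriction> n)"
  by (metis le_add_diff_inverse map_append prefixI upt_add_eq_append zero_le)

text \<open>The search stops at the cutoff, at a divergent value or at a zero. Since
  \<open>n\<close> always meets the first condition, the least such index exists and the search is
  total even where \<open>r\<close> is undefined.\<close>

definition bounded_search :: "nat \<Rightarrow> (nat \<Rightarrow> nat option) \<Rightarrow> nat option" where
  "bounded_search n r =
     (let k = LEAST k. n \<le> k \<or> r k = None \<or> r k = Some 0 in if r k = Some 0 then Some k else None)"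

lemma bounded_search_iff:
  "bounded_search n r = Some v \<longleftrightarrow> r v = Some 0 \<and> v \<le> n \<and> (\<forall>j<v. \<exists>y. r j = Some (Suc y))"
proof -
  define P where "P k \<longleftrightarrow> n \<le> k \<or> r k = None \<or> r k = Some 0" for k
  define l where "l = Least P"
  have "bounded_search n r = (if r l = Some 0 then Some l else None)"
    unfolding bounded_search_def Let_def P_def[symmetric] l_def ..
  then have search: "bounded_search n r = Some v \<longleftrightarrow> r l = Some 0 \<and> l = v"
    by auto
  have "P n"
    by (simp add: P_def)
  then have "l \<le> n"
    unfolding l_def by (rule Least_le)
  moreover have "\<not> P j" if "j < l" for j
    using that unfolding l_def by (rule not_less_Least)
  moreover have "\<exists>y. r j = Some (Suc y)" if "\<not> P j" for j
    using that by (cases "r j") (auto simp: P_def gr0_conv_Suc)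
  moreover have "l = v" if v: "r v = Some 0" "v \<le> n" "\<forall>j<v. \<exists>y. r j = Some (Suc y)"
    unfolding l_def
  proof (rule Least_equality)
    show "P v" using v by (simp add: P_def)
    show "v \<le> j" if "P j" for j
    proof (rule ccontr)
      assume "\<not> v \<le> j"
      with v have "\<exists>y. r j = Some (Suc y)" "\<not> n \<le> j"
        by auto
      with \<open>P j\<close> show False
        by (auto simp: P_def)
    qed
  qed
  ultimately show ?thesis
    unfolding search by blast
qed

lemma min_search_iff:
  "min_search r = Some v \<longleftrightarrow> r v = Some 0 \<and> (\<forall>j<v. \<exists>y. r j = Some (Suc y))"
proof -
  have *: "(LEAST k. r k = Some 0) = v" if "r v = Some 0" "\<forall>j<v. \<exists>y. r j = Some (Suc y)" for v
    using that by (intro Least_equality) (auto intro: leI)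
  show ?thesis
    unfolding min_search_def using * by auto
qed

text \<open>
  Searches are cut off at the length of the oracle string. This makes \<open>run_fin\<close> total and recursive,
  and loses no halting computation in the limit.
\<close>

primrec run_fin :: "nat list \<Rightarrow> prog \<Rightarrow> nat \<Rightarrow> nat option" where
  "run_fin \<alpha> Zero = (\<lambda>x. Some 0)"
| "run_fin \<alpha> Succ = (\<lambda>x. Some (Suc x))"
| "run_fin \<alpha> Fst = (\<lambda>x. Some (fst (prod_decode x)))"
| "run_fin \<alpha> Snd = (\<lambda>x. Some (snd (prod_decode x)))"
| "run_fin \<alpha> Query = (\<lambda>x. if x < length \<alpha> then Some (nth_default 0 \<alpha> x) else None)"
| "run_fin \<alpha> (Pack p q) =
     (\<lambda>x. Option.bind (run_fin \<alpha> p x)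
        (\<lambda>u. Option.bind (run_fin \<alpha> q x) (\<lambda>v. Some (prod_encode (u, v)))))"
| "run_fin \<alpha> (Seq p q) = (\<lambda>x. Option.bind (run_fin \<alpha> p x) (run_fin \<alpha> q))"
| "run_fin \<alpha> (Prec p q) =
     (\<lambda>x. rec_nat (run_fin \<alpha> p (fst (prod_decode x)))
            (\<lambda>i r. Option.bind r
               (\<lambda>y. run_fin \<alpha> q (prod_encode (fst (prod_decode x), prod_encode (i, y)))))
            (snd (prod_decode x)))"
| "run_fin \<alpha> (Mu p) = (\<lambda>x. bounded_search (length \<alpha>) (\<lambda>k. run_fin \<alpha> p (prod_encode (x, k))))"

text \<open>Shared by \<open>run_fin_mono\<close> and \<open>run_fin_sound\<close>: in both, the
  \<open>Prec\<close> case compares two recursions whose bases and steps are related by the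
  induction hypotheses.\<close>

lemma rec_nat_option_mono:
  assumes "rec_nat a (\<lambda>i r. Option.bind r (s i)) n = Some v"
    and "\<And>v. a = Some v \<Longrightarrow> a' = Some v"
    and "\<And>i y v. s i y = Some v \<Longrightarrow> s' i y = Some v"
  shows "rec_nat a' (\<lambda>i r. Option.bind r (s' i)) n = Some v"
  using assms by (induction n arbitrary: v) (auto simp: bind_eq_Some_conv)

text \<open>A longer oracle string answers more queries and moves every cutoff outwards. A search
  that ended at a zero saw only defined values before it, so it ends at the same place.\<close>

lemma run_fin_mono:
  assumes "prefix \<alpha> \<beta>" "run_fin \<alpha> p x = Some v"
  shows "run_fin \<beta> p x = Some v"
  using assms(2)
proof (induction p arbitrary: x v)
  case Query
  then show ?case
    using assms(1) by (auto simp: prefix_def nth_default_def nth_append split: if_splits)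
next
  case (Prec p q)
  then show ?case
    unfolding run_fin.simps
    by (elim rec_nat_option_mono) (rule Prec.IH, assumption)+
next
  case (Mu p)
  then show ?case
    using prefix_length_le[OF assms(1)] by (fastforce simp: bounded_search_iff)
qed (fastforce simp: bind_eq_Some_conv)+

lemma run_fin_sound:
  assumes "run_fin (g \<restriction> n) p x = Some v"
  shows "run g p x = Some v"
  using assms
proof (induction p arbitrary: x v)
  case Query
  then show ?case
    by (auto simp: nth_default_nth split: if_splits)
next
  case (Prec p q)
  then show ?case
    unfolding run_fin.simps run.simps
    by (elim rec_nat_option_mono) (rule Prec.IH, assumption)+
next
  case (Mu p)
  then show ?case
    by (fastforce simp: bounded_search_iff min_search_iff)
qed (fastforce simp: bind_eq_Some_conv)+

text \<open>A halting computation consults the oracle finitely often. The initial segments used by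
  its subcomputations are merged into a longer one by \<open>run_fin_mono\<close>.\<close>

lemma use_principle:
  assumes "run g p x = Some v"
  shows "\<exists>n. run_fin (g \<restriction> n) p x = Some v"
  using assms
proof (induction p arbitrary: x v)
  case Query
  then show ?case
    by (intro exI[of _ "Suc x"]) (auto simp: nth_default_nth simp del: upt_Suc)
next
  case (Pack p q)
  then obtain u w where "run g p x = Some u" "run g q x = Some w" and v: "v = prod_encode (u, w)"
    by (auto simp: bind_eq_Some_conv)
  with Pack.IH obtain m n where
    "run_fin (g \<restriction> m) p x = Some u" "run_fin (g \<restriction> n) q x = Some w"
    by metis
  then have "run_fin (g \<restriction> (max m n)) p x = Some u" "run_fin (g \<restriction> (max m n)) q x = Some w"
    by (meson run_fin_mono restrict_prefix max.cobounded1 max.cobounded2)+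
  then show ?case
    unfolding v by (intro exI[of _ "max m n"]) simp
next
  case (Seq p q)
  then obtain u where "run g p x = Some u" "run g q u = Some v"
    by (auto simp: bind_eq_Some_conv)
  with Seq.IH obtain m n where
    "run_fin (g \<restriction> m) p x = Some u" "run_fin (g \<restriction> n) q u = Some v"
    by metis
  then have "run_fin (g \<restriction> (max m n)) p x = Some u" "run_fin (g \<restriction> (max m n)) q u = Some v"
    by (meson run_fin_mono restrict_prefix max.cobounded1 max.cobounded2)+
  then show ?case
    by (intro exI[of _ "max m n"]) simp
next
  case (Prec p q)
  obtain a l where x: "x = prod_encode (a, l)"
    by (metis prod_decode_inverse surj_pair)
  have "\<exists>n. run_fin (g \<restriction> n) (Prec p q) (prod_encode (a, l)) = Some v"
    if "run g (Prec p q) (prod_encode (a, l)) = Some v"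
    using that
  proof (induction l arbitrary: v)
    case 0
    then show ?case using Prec.IH(1) by simp
  next
    case (Suc l)
    then obtain y where "run g (Prec p q) (prod_encode (a, l)) = Some y"
      "run g q (prod_encode (a, prod_encode (l, y))) = Some v"
      by (auto simp: bind_eq_Some_conv)
    with Suc.IH Prec.IH(2) obtain m n where
      "run_fin (g \<restriction> m) (Prec p q) (prod_encode (a, l)) = Some y"
      "run_fin (g \<restriction> n) q (prod_encode (a, prod_encode (l, y))) = Some v"
      by metis
    then have "run_fin (g \<restriction> (max m n)) (Prec p q) (prod_encode (a, l)) = Some y"
      "run_fin (g \<restriction> (max m n)) q (prod_encode (a, prod_encode (l, y))) = Some v"
      by (meson run_fin_mono restrict_prefix max.cobounded1 max.cobounded2)+
    then show ?case
      by (intro exI[of _ "max m n"]) simp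
  qed
  then show ?case
    using Prec.prems unfolding x by blast
next
  case (Mu p)
  then have v: "run g p (prod_encode (x, v)) = Some 0"
    "\<And>j. j < v \<Longrightarrow> \<exists>y. run g p (prod_encode (x, j)) = Some (Suc y)"
    by (auto simp: min_search_iff)
  have "\<exists>n. j \<le> v \<longrightarrow> run_fin (g \<restriction> n) p (prod_encode (x, j)) = run g p (prod_encode (x, j))" for j
    using v Mu.IH by (metis le_neq_implies_less)
  then obtain N where
    N: "\<And>j. j \<le> v \<Longrightarrow> run_fin (g \<restriction> N j) p (prod_encode (x, j)) = run g p (prod_encode (x, j))"
    by metis
  \<comment> \<open>The sum dominates every \<open>N j\<close>; the summand \<open>v\<close> moves
    the cutoff of the search out to the zero at \<open>v\<close>.\<close>
  define n where "n = v + (\<Sum>j\<le>v. N j)"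
  have n: "N j \<le> n" if "j \<le> v" for j
    unfolding n_def using that by (simp add: member_le_sum trans_le_add2)
  have "run_fin (g \<restriction> n) p (prod_encode (x, v)) = Some 0"
    using N[of v] v(1) run_fin_mono[OF restrict_prefix[OF n[of v]]] by simp
  moreover have "\<exists>y. run_fin (g \<restriction> n) p (prod_encode (x, j)) = Some (Suc y)" if "j < v" for j
    using N[of j] v(2)[OF that] run_fin_mono[OF restrict_prefix[OF n[of j]]] that by fastforce
  ultimately have "run_fin (g \<restriction> n) (Mu p) x = Some v"
    by (simp add: bounded_search_iff n_def)
  then show ?case by blast
qed simp_all

lemma recursive_prod_encode [recursive_intros]:
  assumes "recursive f" shows "recursive (\<lambda>x. prod_encode (f x))"
  by (rule recursive_app[OF _ assms], rule recursive_by_code) (auto simp: encode_simps)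

lemma recursive_prod_decode [recursive_intros]:
  assumes "recursive f" shows "recursive (\<lambda>x. prod_decode (f x))"
  by (rule recursive_app[OF _ assms], rule recursive_by_code)
    (metis encode_simps(1,6) prod.exhaust prod_decode_inverse)

lemma recursive_bounded_search [recursive_intros]:
  fixes r :: "'a::coded \<Rightarrow> nat \<Rightarrow> nat option"
  assumes "recursive (\<lambda>z. r (fst z) (snd z))" "recursive n"
  shows "recursive (\<lambda>x. bounded_search (n x) (r x))"
proof -
  have least: "recursive (\<lambda>x. LEAST k. n x \<le> k \<or> r x k = None \<or> r x k = Some 0)" (is "recursive ?k")
    using assms recursive_app[OF assms(2) recursive_fst[OF recursive_id]]
    by (intro recursive_intros) auto
  from recursive_app[OF assms(1) recursive_Pair[OF recursive_id this]]
  have "recursive (\<lambda>x. r x (?k x))"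
    by simp
  from recursive_if[OF decidable_eq[OF this recursive_const] recursive_Some[OF least] recursive_const]
  show ?thesis
    unfolding bounded_search_def Let_def .
qed

lemma recursive_run_fin [recursive_intros]:
  assumes "recursive \<alpha>" "recursive f"
  shows "recursive (\<lambda>x. run_fin (\<alpha> x) p (f x))"
proof -
  have app: "recursive (\<lambda>x. run_fin (\<alpha> x) p (f x))"
    if "recursive (\<lambda>z. run_fin (fst z) p (snd z))" "recursive \<alpha>" "recursive f"
    for p \<alpha> and f :: "'c::coded \<Rightarrow> nat"
    using recursive_app[OF that(1) recursive_Pair[OF that(2,3)]] by simp
  \<comment> \<open>With string and input as a single argument, the induction hypotheses can be
    applied by \<open>app\<close> to the intermediate values of the computation.\<close>
  have "recursive (\<lambda>z. run_fin (fst z) p (snd z))"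
  proof (induction p)
    case Query
    show ?case
      unfolding run_fin.simps by (intro recursive_intros)
  next
    case (Pack p q)
    show ?case
      unfolding run_fin.simps by (intro recursive_intros app[OF Pack.IH(1)] app[OF Pack.IH(2)])
  next
    case (Seq p q)
    show ?case
      unfolding run_fin.simps by (intro recursive_intros app[OF Seq.IH(1)] app[OF Seq.IH(2)])
  next
    case (Prec p q)
    show ?case
      unfolding run_fin.simps by (intro recursive_intros app[OF Prec.IH(1)] app[OF Prec.IH(2)])
  next
    case (Mu p)
    show ?case
      unfolding run_fin.simps by (intro recursive_intros app[OF Mu.IH])
  qed (unfold run_fin.simps, (intro recursive_intros)+)
  from app[OF this assms] show ?thesis .
qed

section \<open>Escaping survival and tracing\<close>

text \<open>As \<open>m s \<le> l\<close>, the forbidden child is one of the \<open>l + 1\<close>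
  candidates, so exactly \<open>l\<close> remain. The assumption that \<open>f\<close> survives
  supplies the bound on its values that puts \<open>f\<close> on the tree.\<close>

lemma not_surviving_if_predicted:
  assumes m: "recursive m" "\<And>s. m s \<le> l" and f: "\<And>n. f n \<noteq> m (f \<restriction> n)"
  shows "\<not> surviving l f"
proof
  assume surv: "surviving l f"
  define T where "T = {s. \<forall>j<length s. s ! j < l + 1 \<and> s ! j \<noteq> m (take j s)}"
  have "tree (l + 1) T"
    unfolding tree_def
  proof (intro conjI ballI allI impI)
    show "T \<subseteq> lists {..<l + 1}"
      by (auto simp: T_def in_set_conv_nth)
    show "\<tau> \<in> T" if "\<sigma> \<in> T" "prefix \<tau> \<sigma>" for \<sigma> \<tau>
    proof -
      obtain \<rho> where \<sigma>: "\<sigma> = \<tau> @ \<rho>" using \<open>prefix \<tau> \<sigma>\<close> by (auto simp: prefix_def)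
      have "\<tau> ! j < l + 1 \<and> \<tau> ! j \<noteq> m (take j \<tau>)" if "j < length \<tau>" for j
      proof -
        have "\<sigma> ! j < l + 1 \<and> \<sigma> ! j \<noteq> m (take j \<sigma>)"
          using \<open>\<sigma> \<in> T\<close> that prefix_length_le[OF \<open>prefix \<tau> \<sigma>\<close>] unfolding T_def by auto
        then show ?thesis
          using that by (simp add: \<sigma> nth_append)
      qed
      then show ?thesis by (simp add: T_def)
    qed
  qed
  moreover have "branching l T"
    unfolding branching_def
  proof (intro ballI disjI2)
    fix \<sigma> assume "\<sigma> \<in> T"
    then have "{i. \<sigma> @ [i] \<in> T} = {..<l + 1} - {m \<sigma>}"
      by (auto simp: T_def nth_append less_Suc_eq)
    then show "card {i. \<sigma> @ [i] \<in> T} = l"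
      using m(2)[of \<sigma>] by (simp add: card_Diff_subset)
  qed
  moreover have "computable_strings T"
  proof -
    \<comment> \<open>\<open>take\<close> and \<open>!\<close> are traded for the total function
      \<open>nth_default\<close>, for which a recursiveness rule is available.\<close>
    have take: "take j s = map (nth_default 0 s) [0..<j]" if "j < length s" for j and s :: "nat list"
      using that by (intro nth_equalityI) (simp_all add: nth_default_nth)
    have "s \<in> T \<longleftrightarrow> (\<forall>j<length s. nth_default 0 s j < l + 1 \<and>
        \<not> nth_default 0 s j = m (map (nth_default 0 s) [0..<j]))" for s
      unfolding T_def by (simp add: nth_default_nth take cong: conj_cong)
    moreover have "decidable (\<lambda>s. \<forall>j<length s. nth_default 0 s j < l + 1 \<and>
        \<not> nth_default 0 s j = m (map (nth_default 0 s) [0..<j]))"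
      by (intro recursive_intros recursive_app[OF m(1)])
    ultimately have "decidable (\<lambda>s. s \<in> T)"
      by simp
    moreover have "decode n = list_decode n" for n
      by (simp add: decode_list_def decode_nat_def map_idI)
    ultimately show ?thesis
      unfolding computable_strings_def decidable_def recursive_def by (simp add: encode_nat_def)
  qed
  moreover have "path_through f T"
  proof -
    have "f j < l + 1" for j
      using surv by (simp add: surviving_def)
    moreover have "f j \<noteq> m (take j (f \<restriction> n))" if "j < n" for j n
      using f[of j] that by (simp add: take_map)
    ultimately show ?thesis
      by (auto simp: path_through_def T_def)
  qed
  ultimately show False
    using surv unfolding surviving_def by blast
qed

text \<open>What the theorem demands of each single function below the degree. The trace bound
  depends on \<open>b\<close> alone, so one computable bound serves all these functions.\<close>

definition tame :: "nat \<Rightarrow> (nat \<Rightarrow> nat) \<Rightarrow> bool" where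
  "tame b f \<longleftrightarrow> (\<forall>l\<ge>b. \<not> surviving l f) \<and>
     (\<exists>D. (\<forall>n. finite (D n)) \<and> computable (\<lambda>n. set_encode (D n)) \<and>
        (\<forall>n. card (D n) \<le> b ^ Suc n \<and> f n \<in> D n))"

lemma tame_if_computable:
  assumes "computable f" "b \<ge> 1"
  shows "tame b f"
  unfolding tame_def
proof (intro conjI allI impI exI)
  have f: "recursive f"
    using assms(1) by (simp add: recursive_nat)
  fix l assume "b \<le> l"
  show "\<not> surviving l f"
  \<comment> \<open>Any value other than \<open>f (length s)\<close> would do; this one is at most
    1, hence at most \<open>l\<close>.\<close>
  proof (rule not_surviving_if_predicted[where m = "\<lambda>s. if f (length s) = 0 then 1 else 0"])
    show "recursive (\<lambda>s :: nat list. if f (length s) = 0 then 1 else 0 :: nat)"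
      by (intro recursive_intros recursive_app[OF f])
  qed (use assms \<open>b \<le> l\<close> in auto)
next
  have "recursive f"
    using assms(1) by (simp add: recursive_nat)
  then have "recursive (\<lambda>n. set_encode (set [f n]))"
    by (intro recursive_intros)
  then show "computable (\<lambda>n. set_encode {f n})"
    by (simp add: recursive_nat)
qed (use assms in auto)

text \<open>
  Here \<open>D t\<close> is the part of a function that is determined by the first \<open>length t\<close> turns of a path
  through a \<open>b\<close>-branching tree of pairwise splitting strings.
\<close>

lemma tame_if_splitting:
  assumes rec: "recursive (\<lambda>z. D (fst z) (snd z))"
    and mono: "\<And>s t x v. prefix s t \<Longrightarrow> D s x = Some v \<Longrightarrow> D t x = Some v"
    and split: "\<And>s. s \<in> lists {..<b} \<Longrightarrow> \<exists>X>length s. (\<forall>i<b. \<forall>x<X. D (s @ [i]) x \<noteq> None) \<and>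
        (\<forall>i<b. \<forall>j<b. i \<noteq> j \<longrightarrow> (\<exists>x<X. D (s @ [i]) x \<noteq> D (s @ [j]) x))"
    and path: "\<And>n. \<exists>t\<in>lists {..<b}. length t = n \<and> (\<forall>x v. D t x = Some v \<longrightarrow> f x = v)"
    and b: "b \<ge> 1"
  shows "tame b f"
proof -
  \<comment> \<open>The length is \<open>n + 1\<close> because the bound \<open>X\<close> at a node
    of length \<open>n\<close> exceeds \<open>n\<close>, so that its children decide every argument
    up to \<open>n\<close>.\<close>
  define L where "L n = List.n_lists (Suc n) [0..<b]" for n
  have L: "set (L n) = {t \<in> lists {..<b}. length t = Suc n}" for n
    unfolding L_def set_n_lists by auto
  have rec_L: "recursive (\<lambda>x. L (h x))" if "recursive h" for h :: "'a::coded \<Rightarrow> nat"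
    unfolding L_def using that by (intro recursive_intros)
  have rec_D: "recursive (\<lambda>x. D (h x) (k x))" if "recursive h" "recursive k"
    for h and k :: "'a::coded \<Rightarrow> nat"
    using recursive_app[OF rec recursive_Pair[OF that]] by simp
  have decided: "D t x \<noteq> None" if t: "t \<in> set (L n)" and x: "x \<le> n" for t x n
  proof -
    obtain s i where s: "t = s @ [i]" "s \<in> lists {..<b}" "i < b" "length s = n"
      using t unfolding L by (cases t rule: rev_cases) auto
    obtain X where "X > length s" "\<forall>i<b. \<forall>x<X. D (s @ [i]) x \<noteq> None"
      using split[OF s(2)] by blast
    then show ?thesis using s x by simp
  qed
  \<comment> \<open>The parameter \<open>c\<close> is there for the induction in
    \<open>V_card\<close>; the predictor uses \<open>c = []\<close> only.\<close>
  define V where "V n \<sigma> c = {v. \<exists>t\<in>set (L n). prefix c t \<and> (\<forall>j<n. D t j = Some (\<sigma> j)) \<and> D t n = Some v}"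
    for n and \<sigma> :: "nat \<Rightarrow> nat" and c
  have V_finite: "finite (V n \<sigma> c)" for n \<sigma> c
  proof (rule finite_subset)
    show "V n \<sigma> c \<subseteq> (\<lambda>t. the (D t n)) ` set (L n)"
      by (force simp: V_def)
  qed simp
  have V_card: "card (V n \<sigma> c) \<le> b" if "c \<in> lists {..<b}" "length c \<le> Suc n" for n \<sigma> c
    using that
  proof (induction "Suc n - length c" arbitrary: c)
    case 0
    then have c: "length c = Suc n" by simp
    have "t = c" if "t \<in> set (L n)" "prefix c t" for t
      using that c unfolding L prefix_def by auto
    then have "V n \<sigma> c \<subseteq> {the (D c n)}"
      by (force simp: V_def)
    from card_mono[OF _ this] show ?case
      using b by simp
  next
    case (Suc k)
    show ?case
    \<comment> \<open>If one child carries all values, the count passes to it. If none does, every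
      child that carries a value has a rival that carries another one, and the splitting of the two
      can be exploited.\<close>
    proof (cases "\<exists>i<b. V n \<sigma> c \<subseteq> V n \<sigma> (c @ [i])")
      case True
      then obtain i where i: "i < b" "V n \<sigma> c \<subseteq> V n \<sigma> (c @ [i])" by blast
      have "card (V n \<sigma> (c @ [i])) \<le> b"
        using Suc.hyps(2) Suc.prems i(1) by (intro Suc.hyps(1)) simp_all
      with card_mono[OF V_finite i(2)] show ?thesis by simp
    next
      case False
      have child: "\<exists>i<b. v \<in> V n \<sigma> (c @ [i])" if "v \<in> V n \<sigma> c" for v
      proof -
        obtain t where t: "t \<in> set (L n)" "prefix c t" "\<forall>j<n. D t j = Some (\<sigma> j)" "D t n = Some v"
          using \<open>v \<in> V n \<sigma> c\<close> unfolding V_def by blast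
        then obtain u where "t = c @ u" by (auto simp: prefix_def)
        moreover from this obtain i u' where "u = i # u'"
          using t(1) Suc.hyps(2) by (cases u) (auto simp: L)
        ultimately have "i < b" "prefix (c @ [i]) t"
          using t(1) by (auto simp: L)
        with t show ?thesis unfolding V_def by blast
      qed
      obtain X where X: "\<forall>i<b. \<forall>x<X. D (c @ [i]) x \<noteq> None"
        "\<forall>i<b. \<forall>j<b. i \<noteq> j \<longrightarrow> (\<exists>x<X. D (c @ [i]) x \<noteq> D (c @ [j]) x)"
        using split[OF Suc.prems(1)] by blast
      have "v \<in> (\<lambda>i. the (D (c @ [i]) n)) ` {..<b}" if "v \<in> V n \<sigma> c" for v
      proof -
        obtain i where i: "i < b" "v \<in> V n \<sigma> (c @ [i])"
          using child \<open>v \<in> V n \<sigma> c\<close> by blast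
        \<comment> \<open>\<open>v'\<close> serves to produce a second child \<open>j\<close> with a
          consistent string above it.\<close>
        obtain v' where "v' \<in> V n \<sigma> c" "v' \<notin> V n \<sigma> (c @ [i])"
          using False i(1) by blast
        with child obtain j where j: "j < b" "j \<noteq> i" "v' \<in> V n \<sigma> (c @ [j])"
          by blast
        obtain x where x: "x < X" "D (c @ [i]) x \<noteq> D (c @ [j]) x"
          using X(2) i(1) j by blast
        obtain t where t: "prefix (c @ [i]) t" "\<forall>k<n. D t k = Some (\<sigma> k)" "D t n = Some v"
          using i(2) unfolding V_def by blast
        obtain t' where t': "prefix (c @ [j]) t'" "\<forall>k<n. D t' k = Some (\<sigma> k)"
          using j(3) unfolding V_def by blast
        obtain u u' where u: "D (c @ [i]) x = Some u" "D (c @ [j]) x = Some u'"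
          using X(1) x(1) i(1) j(1) by blast
        then have "D t x = Some u" "D t' x = Some u'" "u \<noteq> u'"
          using mono[OF t(1)] mono[OF t'(1)] x(2) by auto
        \<comment> \<open>Below \<open>n\<close> both strings follow \<open>\<sigma>\<close>, so
          they differ at some \<open>x \<ge> n\<close>. From \<open>n \<le> x < X\<close> it follows
          that child \<open>i\<close> already decides \<open>n\<close>, and \<open>v\<close> depends
          on \<open>i\<close> alone.\<close>
        then have "\<not> x < n"
          using t(2) t'(2) by auto
        then obtain w where "D (c @ [i]) n = Some w"
          using X(1) x(1) i(1) by fastforce
        with mono[OF t(1)] t(3) have "D (c @ [i]) n = Some v"
          by simp
        then show ?thesis using i(1) by force
      qed
      then have "V n \<sigma> c \<subseteq> (\<lambda>i. the (D (c @ [i]) n)) ` {..<b}" by blast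
      then have "card (V n \<sigma> c) \<le> card {..<b}"
        by (rule surj_card_le[rotated]) simp
      then show ?thesis by simp
    qed
  qed
  have f: "\<exists>t\<in>set (L n). \<forall>j\<le>n. D t j = Some (f j)" for n
  proof -
    obtain t where t: "t \<in> lists {..<b}" "length t = Suc n" "\<forall>x v. D t x = Some v \<longrightarrow> f x = v"
      using path by blast
    then have "t \<in> set (L n)" by (simp add: L)
    with t(3) decided show ?thesis by blast
  qed
  \<comment> \<open>The least number outside \<open>V\<close>, spelled out over the finite list
    \<open>L (length s)\<close> so that the recursiveness rules apply.\<close>
  define m where "m s = (LEAST v. \<forall>t\<in>set (L (length s)).
      (\<forall>j<length s. D t j = Some (nth_default 0 s j)) \<longrightarrow> D t (length s) \<noteq> Some v)" for s
  have m: "m s = (LEAST v. v \<notin> V (length s) (nth_default 0 s) [])" for s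
    unfolding m_def V_def by (rule arg_cong[where f = Least]) auto
  have small: "\<exists>v\<le>b. v \<notin> V n \<sigma> []" for n \<sigma>
  proof (rule ccontr)
    assume "\<not> ?thesis"
    then have "{..b} \<subseteq> V n \<sigma> []" by auto
    from card_mono[OF V_finite this] V_card[of "[]" n \<sigma>] show False by simp
  qed
  have m_rec: "recursive m"
    unfolding m_def
  proof (intro recursive_intros rec_L rec_D)
    show "\<exists>v. \<forall>t\<in>set (L (length s)).
      (\<forall>j<length s. D t j = Some (nth_default 0 s j)) \<longrightarrow> D t (length s) \<noteq> Some v" for s
      using small[of "length s" "nth_default 0 s"] unfolding V_def by simp blast
  qed
  have m_le: "m s \<le> b" for s
    using small[of "length s" "nth_default 0 s"] unfolding m by (meson Least_le le_trans)
  have m_avoid: "f n \<noteq> m (f \<restriction> n)" for n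
  proof -
    have "f n \<in> V n (nth_default 0 (f \<restriction> n)) []"
    proof -
      obtain t where "t \<in> set (L n)" "\<forall>j\<le>n. D t j = Some (f j)"
        using f by blast
      then show ?thesis
        unfolding V_def by (auto simp: nth_default_nth intro!: bexI[of _ t])
    qed
    moreover have "m (f \<restriction> n) \<notin> V n (nth_default 0 (f \<restriction> n)) []"
      using LeastI_ex[of "\<lambda>v. v \<notin> V n (nth_default 0 (f \<restriction> n)) []"] small unfolding m by auto
    ultimately show ?thesis by auto
  qed
  define T where "T n = map (\<lambda>t. case D t n of None \<Rightarrow> 0 | Some v \<Rightarrow> v) (L n)" for n
  have "recursive (\<lambda>n. set_encode (set (T n)))"
    unfolding T_def by (intro recursive_intros rec_L rec_D)
  moreover have "card (set (T n)) \<le> b ^ Suc n" for n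
    using card_length[of "T n"] length_n_lists[of "Suc n" "[0..<b]"]
    unfolding T_def L_def length_map by simp
  moreover have "f n \<in> set (T n)" for n
    using f[of n] by (force simp: T_def)
  moreover have "\<not> surviving l f" if "b \<le> l" for l
    by (rule not_surviving_if_predicted[OF m_rec le_trans[OF m_le that] m_avoid])
  ultimately show ?thesis
    unfolding tame_def recursive_nat by (intro conjI exI[of _ "\<lambda>n. set (T n)"]) auto
qed

section \<open>Forcing with computable perfect trees\<close>

text \<open>
  A condition maps the full \<open>b\<close>-branching tree onto the branching nodes of a perfect tree; the
  strings \<open>F s @ [i]\<close> with \<open>i < b\<close> are the children of the branching node \<open>F s\<close>.
\<close>

definition condition :: "nat \<Rightarrow> (nat list \<Rightarrow> nat list) \<Rightarrow> bool" where
  "condition b F \<longleftrightarrow> recursive F \<and> (\<forall>s i. prefix (F s @ [i]) (F (s @ [i]))) \<and>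
     (\<forall>s\<in>lists {..<b}. F s \<in> lists {..<b})"

lemma condition_prefix:
  assumes "condition b F" "prefix s t"
  shows "prefix (F s) (F t)"
proof -
  have "prefix (F s) (F (s @ u))" for u
  proof (induction u rule: rev_induct)
    case (snoc i u)
    have "prefix (F (s @ u) @ [i]) (F ((s @ u) @ [i]))"
      using assms(1) unfolding condition_def by blast
    with snoc show ?case
      by (metis append_assoc append_prefixD prefix_order.trans)
  qed simp
  then show ?thesis
    using assms(2) by (auto simp: prefix_def[of s])
qed

text \<open>Each index symbol is itself appended to the node, so depth in the index tree is a lower
  bound for growth in the tree.\<close>

lemma condition_length:
  assumes "condition b F"
  shows "length (F s) + length t \<le> length (F (s @ t))"
proof (induction t rule: rev_induct)
  case (snoc i t)
  have "prefix (F (s @ t) @ [i]) (F ((s @ t) @ [i]))"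
    using assms unfolding condition_def by blast
  from prefix_length_le[OF this] snoc show ?case
    by simp
qed simp

lemma condition_id: "condition b (\<lambda>s. s)"
  by (auto simp: condition_def intro: recursive_intros)

text \<open>Composition is refinement: \<open>G\<close> selects index strings, so the branching
  nodes of the composition are among those of \<open>F\<close>.\<close>

lemma condition_compose:
  assumes "condition b F" "condition b G"
  shows "condition b (\<lambda>s. F (G s))"
proof -
  have "prefix (F (G s) @ [i]) (F (G (s @ [i])))" for s i
    using assms condition_prefix[OF assms(1), of "G s @ [i]" "G (s @ [i])"]
    unfolding condition_def by (meson prefix_order.trans)
  then show ?thesis
    using assms recursive_app[of F G] unfolding condition_def by blast
qed

text \<open>Composing a condition with this one restricts it to the part above the node with index
  \<open>\<sigma>\<close>.\<close>

lemma condition_append: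
  assumes "\<sigma> \<in> lists {..<b}"
  shows "condition b (\<lambda>s. \<sigma> @ s)"
  using assms by (auto simp: condition_def intro!: recursive_intros)

section \<open>Subtrees with pairwise splitting children\<close>

text \<open>Pairs are treated one at a time, and monotonicity preserves earlier splits. For
  \<open>(i, j)\<close> an argument with two different values above \<open>i\<close> is chosen and
  \<open>j\<close> is extended to decide it; then \<open>i\<close> takes whichever of its two values
  differs from that of \<open>j\<close>.\<close>

lemma exists_splitting_extensions:
  fixes W :: "nat list \<Rightarrow> nat \<Rightarrow> nat option"
  assumes mono: "\<And>s t x v. prefix s t \<Longrightarrow> W s x = Some v \<Longrightarrow> W t x = Some v"
    and total: "\<And>\<sigma> x. \<sigma> \<in> lists A \<Longrightarrow> \<exists>t\<in>lists A. W (\<sigma> @ t) x \<noteq> None"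
    and split: "\<And>\<sigma>. \<sigma> \<in> lists A \<Longrightarrow> \<exists>x t t' v v'. t \<in> lists A \<and> t' \<in> lists A \<and>
        W (\<sigma> @ t) x = Some v \<and> W (\<sigma> @ t') x = Some v' \<and> v \<noteq> v'"
    and \<rho>: "\<And>i. \<rho> i \<in> lists A" and P: "finite P" "\<And>i j. (i, j) \<in> P \<Longrightarrow> i \<noteq> j"
  shows "\<exists>e. (\<forall>i. e i \<in> lists A) \<and> (\<forall>i j. (i, j) \<in> P \<longrightarrow> (\<exists>x v v'.
      W (\<rho> i @ e i) x = Some v \<and> W (\<rho> j @ e j) x = Some v' \<and> v \<noteq> v'))"
  using P
proof (induction P rule: finite_induct)
  case empty
  show ?case by (intro exI[of _ "\<lambda>_. []"]) simp
next
  case (insert p P)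
  obtain i j where p: "p = (i, j)" by (cases p)
  have "i \<noteq> j" using insert.prems p by blast
  have "\<exists>e. (\<forall>k. e k \<in> lists A) \<and> (\<forall>k l. (k, l) \<in> P \<longrightarrow> (\<exists>x v v'.
      W (\<rho> k @ e k) x = Some v \<and> W (\<rho> l @ e l) x = Some v' \<and> v \<noteq> v'))"
    by (rule insert.IH) (use insert.prems in blast)
  then obtain e where e: "\<And>k. e k \<in> lists A"
    and sep: "\<And>k l. (k, l) \<in> P \<Longrightarrow>
      \<exists>x v v'. W (\<rho> k @ e k) x = Some v \<and> W (\<rho> l @ e l) x = Some v' \<and> v \<noteq> v'"
    by blast
  have in_A: "\<rho> k @ e k \<in> lists A" for k
    using \<rho>[of k] e[of k] by simp
  obtain x t t' v v' where t: "t \<in> lists A" "t' \<in> lists A"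
    "W ((\<rho> i @ e i) @ t) x = Some v" "W ((\<rho> i @ e i) @ t') x = Some v'" "v \<noteq> v'"
    using split[OF in_A] by blast
  obtain u w where u: "u \<in> lists A" "W ((\<rho> j @ e j) @ u) x = Some w"
    using total[OF in_A] by blast
  obtain t'' v'' where t'': "t'' \<in> lists A" "W ((\<rho> i @ e i) @ t'') x = Some v''" "v'' \<noteq> w"
    using t by metis
  define e' where "e' = e(i := e i @ t'', j := e j @ u)"
  have pre: "prefix (\<rho> k @ e k) (\<rho> k @ e' k)" for k
    by (simp add: e'_def)
  show ?case
  proof (intro exI[of _ e'] conjI)
    show "\<forall>k. e' k \<in> lists A"
      using e u(1) t''(1) by (simp add: e'_def)
    have "\<exists>x v v'. W (\<rho> k @ e' k) x = Some v \<and> W (\<rho> l @ e' l) x = Some v' \<and> v \<noteq> v'"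
      if "(k, l) \<in> P" for k l
      using sep[OF that] mono[OF pre] by meson
    moreover have "W (\<rho> i @ e' i) x = Some v''" "W (\<rho> j @ e' j) x = Some w"
      using t''(2) u(2) \<open>i \<noteq> j\<close> by (simp_all add: e'_def)
    ultimately show "\<forall>k l. (k, l) \<in> insert p P \<longrightarrow> (\<exists>x v v'.
        W (\<rho> k @ e' k) x = Some v \<and> W (\<rho> l @ e' l) x = Some v' \<and> v \<noteq> v')"
      using t''(3) unfolding p by blast
  qed
qed

lemma exists_deciding_extension:
  fixes W :: "nat list \<Rightarrow> nat \<Rightarrow> nat option"
  assumes mono: "\<And>s t x v. prefix s t \<Longrightarrow> W s x = Some v \<Longrightarrow> W t x = Some v"
    and total: "\<And>\<sigma> x. \<sigma> \<in> lists A \<Longrightarrow> \<exists>t\<in>lists A. W (\<sigma> @ t) x \<noteq> None"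
    and \<sigma>: "\<sigma> \<in> lists A"
  shows "\<exists>t\<in>lists A. \<forall>x<X. W (\<sigma> @ t) x \<noteq> None"
proof (induction X)
  case 0
  show ?case by (intro bexI[of _ "[]"]) simp_all
next
  case (Suc X)
  then obtain t where t: "t \<in> lists A" "\<forall>x<X. W (\<sigma> @ t) x \<noteq> None" by blast
  then obtain u where u: "u \<in> lists A" "W ((\<sigma> @ t) @ u) X \<noteq> None"
    using total[of "\<sigma> @ t" X] \<sigma> by auto
  have "W (\<sigma> @ t @ u) x \<noteq> None" if "x < Suc X" for x
  proof (cases "x = X")
    case False
    then have "x < X" using \<open>x < Suc X\<close> by simp
    then obtain v where "W (\<sigma> @ t) x = Some v" using t(2) by auto
    then show ?thesis using mono[of "\<sigma> @ t" "\<sigma> @ t @ u" x v] by simp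
  qed (use u in simp)
  with t(1) u(1) show ?case by (intro bexI[of _ "t @ u"]) auto
qed

text \<open>A witness for one node is finite, namely a bound \<open>X\<close> and one extension per
  child, and checking it is decidable. A search therefore finds it, and iterating the search along
  the index string gives a recursive map.\<close>

lemma splitting_condition:
  fixes W :: "nat list \<Rightarrow> nat \<Rightarrow> nat option"
  assumes rec: "recursive (\<lambda>z. W (fst z) (snd z))"
    and mono: "\<And>s t x v. prefix s t \<Longrightarrow> W s x = Some v \<Longrightarrow> W t x = Some v"
    and total: "\<And>\<sigma> x. \<sigma> \<in> lists {..<b} \<Longrightarrow> \<exists>t\<in>lists {..<b}. W (\<sigma> @ t) x \<noteq> None"
    and split: "\<And>\<sigma>. \<sigma> \<in> lists {..<b} \<Longrightarrow> \<exists>x t t' v v'. t \<in> lists {..<b} \<and> t' \<in> lists {..<b} \<and>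
        W (\<sigma> @ t) x = Some v \<and> W (\<sigma> @ t') x = Some v' \<and> v \<noteq> v'"
  shows "\<exists>G. condition b G \<and> (\<forall>s\<in>lists {..<b}. \<exists>X>length s.
      (\<forall>i<b. \<forall>x<X. W (G (s @ [i])) x \<noteq> None) \<and>
      (\<forall>i<b. \<forall>j<b. i \<noteq> j \<longrightarrow> (\<exists>x<X. W (G (s @ [i])) x \<noteq> W (G (s @ [j])) x)))"
proof -
  define child where "child \<sigma> e i = \<sigma> @ i # nth_default [] e i" for \<sigma> :: "nat list" and e i
  define good where "good \<sigma> z \<longleftrightarrow> length \<sigma> < fst z \<and> (\<forall>\<tau>\<in>set (snd z). \<forall>i\<in>set \<tau>. i < b) \<and>
      (\<forall>i<b. \<forall>x<fst z. \<not> W (child \<sigma> (snd z) i) x = None) \<and>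
      (\<forall>i<b. \<forall>j<b. i = j \<or> (\<exists>x<fst z. \<not> W (child \<sigma> (snd z) i) x = W (child \<sigma> (snd z) j) x))"
    for \<sigma> and z :: "nat \<times> nat list list"
  have ex: "\<exists>z. good \<sigma> z" if \<sigma>: "\<sigma> \<in> lists {..<b}" for \<sigma>
  proof -
    \<comment> \<open>Outside \<open>i < b\<close> the value \<open>\<sigma>\<close> keeps
      \<open>\<rho> i\<close> in \<open>lists {..<b}\<close>, since the extension lemma speaks of
      all indices.\<close>
    define \<rho> where "\<rho> i = (if i < b then \<sigma> @ [i] else \<sigma>)" for i
    have \<rho>: "\<rho> i \<in> lists {..<b}" for i
      using \<sigma> by (simp add: \<rho>_def)
    define P where "P = {(i, j). i < b \<and> j < b \<and> i \<noteq> j}"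
    have "finite P"
      by (rule finite_subset[of _ "{..<b} \<times> {..<b}"]) (auto simp: P_def)
    have P_irrefl: "\<And>i j. (i, j) \<in> P \<Longrightarrow> i \<noteq> j"
      by (simp add: P_def)
    have "\<exists>e. (\<forall>i. e i \<in> lists {..<b}) \<and> (\<forall>i j. (i, j) \<in> P \<longrightarrow>
        (\<exists>x v v'. W (\<rho> i @ e i) x = Some v \<and> W (\<rho> j @ e j) x = Some v' \<and> v \<noteq> v'))"
      by (rule exists_splitting_extensions)
        (fact mono total split \<rho> \<open>finite P\<close> P_irrefl)+
    then obtain e where e: "\<And>i. e i \<in> lists {..<b}"
      and sep: "\<forall>i j. (i, j) \<in> P \<longrightarrow>
        (\<exists>x v v'. W (\<rho> i @ e i) x = Some v \<and> W (\<rho> j @ e j) x = Some v' \<and> v \<noteq> v')"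
      by blast
    from sep have "\<forall>p\<in>P. \<exists>x. \<exists>v v'. W (\<rho> (fst p) @ e (fst p)) x = Some v \<and>
        W (\<rho> (snd p) @ e (snd p)) x = Some v' \<and> v \<noteq> v'"
      by auto
    then obtain x where x: "\<And>p. p \<in> P \<Longrightarrow> \<exists>v v'. W (\<rho> (fst p) @ e (fst p)) (x p) = Some v \<and>
        W (\<rho> (snd p) @ e (snd p)) (x p) = Some v' \<and> v \<noteq> v'"
      by metis
    \<comment> \<open>Above the splitting arguments of all pairs and above
      \<open>length \<sigma>\<close>. Deciding everything below \<open>X\<close> comes last, as
      further extension keeps the splits.\<close>
    define X where "X = Suc (length \<sigma> + (\<Sum>p\<in>P. x p))"
    have xX: "x p < X" if "p \<in> P" for p
      using member_le_sum[OF that, of x] \<open>finite P\<close> by (simp add: X_def)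
    have \<rho>e: "\<rho> i @ e i \<in> lists {..<b}" for i
      using \<rho>[of i] e[of i] by simp
    have "\<exists>d\<in>lists {..<b}. \<forall>x<X. W ((\<rho> i @ e i) @ d) x \<noteq> None" for i
      by (rule exists_deciding_extension) (fact mono total \<rho>e)+
    then obtain d where d: "\<And>i. d i \<in> lists {..<b}" "\<And>i x. x < X \<Longrightarrow> W ((\<rho> i @ e i) @ d i) x \<noteq> None"
      by metis
    define z where "z = (X, map (\<lambda>i. e i @ d i) [0..<b])"
    have child: "child \<sigma> (snd z) i = (\<rho> i @ e i) @ d i" if "i < b" for i
      using that by (simp add: child_def z_def nth_default_nth \<rho>_def)
    have "\<exists>x<X. W (child \<sigma> (snd z) i) x \<noteq> W (child \<sigma> (snd z) j) x" if ij: "i < b" "j < b" "i \<noteq> j" for i j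
    proof -
      have "(i, j) \<in> P" using ij by (simp add: P_def)
      from x[OF this] obtain v v' where v: "W (\<rho> i @ e i) (x (i, j)) = Some v"
        "W (\<rho> j @ e j) (x (i, j)) = Some v'" "v \<noteq> v'"
        by auto
      have "W (child \<sigma> (snd z) i) (x (i, j)) = Some v" "W (child \<sigma> (snd z) j) (x (i, j)) = Some v'"
        unfolding child[OF ij(1)] child[OF ij(2)]
        by (rule mono[OF _ v(1)], simp, rule mono[OF _ v(2)], simp)
      then show ?thesis
        using v(3) xX[OF \<open>(i, j) \<in> P\<close>] by auto
    qed
    moreover have "\<forall>\<tau>\<in>set (snd z). \<forall>i\<in>set \<tau>. i < b"
      using e d(1) by (fastforce simp: z_def)
    moreover have "fst z = X" "length \<sigma> < X"
      by (simp_all add: z_def X_def)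
    ultimately have "good \<sigma> z"
      unfolding good_def using d(2) by (auto simp: child)
    then show ?thesis by blast
  qed
  have rec_W: "recursive (\<lambda>x. W (h x) (k x))" if "recursive h" "recursive k"
    for h and k :: "'a::coded \<Rightarrow> nat"
    using recursive_app[OF rec recursive_Pair[OF that]] by simp
  have rec_child: "recursive (\<lambda>x. child (h x) (e x) (k x))" if "recursive h" "recursive e" "recursive k"
    for h e and k :: "'a::coded \<Rightarrow> nat"
    unfolding child_def using that by (intro recursive_intros)
  have "decidable (\<lambda>z. good (fst z) (snd z))"
    unfolding good_def by (intro recursive_intros rec_W rec_child)
  then have dec_good: "decidable (\<lambda>x. good (h x) (k x))" if "recursive h" "recursive k"
    for h and k :: "'a::coded \<Rightarrow> nat \<times> nat list list"
    using decidable_app[OF _ recursive_Pair[OF that], of "\<lambda>z. good (fst z) (snd z)"] by simp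
  have rec_decode: "recursive (\<lambda>x. decode (k x) :: nat \<times> nat list list)" if "recursive k"
    for k :: "'a::coded \<Rightarrow> nat"
    by (rule recursive_app[OF recursive_by_code that]) (simp add: encode_simps)
  text \<open>Outside \<open>lists {..<b}\<close> the search need not succeed; the second disjunct keeps it total.\<close>
  define pick where
    "pick \<sigma> = (decode (LEAST n. good \<sigma> (decode n) \<or>
      (\<exists>i<length \<sigma>. b \<le> nth_default 0 \<sigma> i)) :: nat \<times> nat list list)" for \<sigma>
  have in_lists: "(\<exists>i<length \<sigma>. b \<le> nth_default 0 \<sigma> i) \<longleftrightarrow> \<sigma> \<notin> lists {..<b}" for \<sigma>
    by (auto simp: in_set_conv_nth nth_default_nth not_le[symmetric] lists_eq_set subset_iff)
  have good_ex: "\<exists>n. good \<sigma> (decode n) \<or> (\<exists>i<length \<sigma>. b \<le> nth_default 0 \<sigma> i)" for \<sigma>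
    using ex[of \<sigma>] unfolding in_lists by (metis decode_encode)
  have rec_pick: "recursive (\<lambda>x. pick (k x))" if "recursive k" for k :: "'a::coded \<Rightarrow> nat list"
  proof -
    have "recursive pick"
      unfolding pick_def by (intro rec_decode recursive_intros dec_good good_ex)
    from recursive_app[OF this that] show ?thesis .
  qed
  have pick: "good \<sigma> (pick \<sigma>)" if "\<sigma> \<in> lists {..<b}" for \<sigma>
    using LeastI_ex[OF good_ex[of \<sigma>]] that unfolding pick_def in_lists by blast
  define G where "G s = foldl (\<lambda>\<sigma> i. child \<sigma> (snd (pick \<sigma>)) i) [] s" for s
  have G: "G (s @ [i]) = child (G s) (snd (pick (G s))) i" for s i
    by (simp add: G_def)
  have G_lists: "G s \<in> lists {..<b}" if "s \<in> lists {..<b}" for s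
    using that
  proof (induction s rule: rev_induct)
    case (snoc i s)
    then have "good (G s) (pick (G s))" using pick by simp
    then have "nth_default [] (snd (pick (G s))) i \<in> lists {..<b}"
      by (auto simp: good_def nth_default_def)
    with snoc show ?case by (simp add: G child_def)
  qed (simp add: G_def)
  have "recursive G"
    unfolding G_def by (intro recursive_intros rec_child rec_pick)
  then have "condition b G"
    using G_lists by (auto simp: condition_def G child_def)
  moreover have "\<exists>X>length s. (\<forall>i<b. \<forall>x<X. W (G (s @ [i])) x \<noteq> None) \<and>
      (\<forall>i<b. \<forall>j<b. i \<noteq> j \<longrightarrow> (\<exists>x<X. W (G (s @ [i])) x \<noteq> W (G (s @ [j])) x))"
    if "s \<in> lists {..<b}" for s
  proof -
    \<comment> \<open>\<open>good\<close> compares \<open>X\<close> with the length of the node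
      \<open>G s\<close>, whereas the goal asks about the index \<open>s\<close>.\<close>
    have "length s \<le> length (G s)"
      using condition_length[OF \<open>condition b G\<close>, of "[]" s] by simp
    with pick[OF G_lists[OF that]] show ?thesis
      unfolding good_def G by (intro exI[of _ "fst (pick (G s))"]) auto
  qed
  ultimately show ?thesis by blast
qed

section \<open>Paths through a condition\<close>

text \<open>The paths through the perfect tree of \<open>F\<close>. Counting by index length
  provides a node on the path at every branching level.\<close>

definition branch :: "nat \<Rightarrow> (nat list \<Rightarrow> nat list) \<Rightarrow> (nat \<Rightarrow> nat) \<Rightarrow> bool" where
  "branch b F g \<longleftrightarrow> (\<forall>n. \<exists>s\<in>lists {..<b}. length s = n \<and> F s = g \<restriction> length (F s))"

lemma prefix_restrict_eq:
  assumes "prefix \<sigma> \<tau>" "\<tau> = g \<restriction> length \<tau>"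
  shows "\<sigma> = g \<restriction> length \<sigma>"
proof (rule nth_equalityI)
  fix j assume j: "j < length \<sigma>"
  then have "\<sigma> ! j = \<tau> ! j" "j < length \<tau>"
    using assms(1) by (auto simp: prefix_def nth_append)
  moreover have "(g \<restriction> length \<tau>) ! j = g j"
    using \<open>j < length \<tau>\<close> by simp
  ultimately show "\<sigma> ! j = (g \<restriction> length \<sigma>) ! j"
    using j assms(2) by simp
qed simp

lemma branch_refine:
  assumes F: "condition b F" and H: "condition b H" and g: "branch b (\<lambda>s. F (H s)) g"
  shows "branch b F g"
  unfolding branch_def
proof
  fix n
  obtain s where s: "s \<in> lists {..<b}" "length s = n" "F (H s) = g \<restriction> length (F (H s))"
    using g unfolding branch_def by blast
  have "n \<le> length (H s)"
    using condition_length[OF H, of "[]" s] s(2) by simp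
  moreover have "take n (H s) \<in> lists {..<b}"
    using H s(1) unfolding condition_def by (meson in_listsD in_listsI in_set_takeD)
  moreover have "prefix (F (take n (H s))) (F (H s))"
    by (rule condition_prefix[OF F take_is_prefix])
  ultimately show "\<exists>s\<in>lists {..<b}. length s = n \<and> F s = g \<restriction> length (F s)"
    using prefix_restrict_eq s(3) by (intro bexI[of _ "take n (H s)"]) auto
qed

lemma branch_initial:
  assumes "branch b F g"
  shows "F [] = g \<restriction> length (F [])"
proof -
  obtain s where "length s = 0" "F s = g \<restriction> length (F s)"
    using assms unfolding branch_def by blast
  then show ?thesis by simp
qed

text \<open>A halting computation uses only an initial segment of its oracle, and some branching
  node on the path extends that segment.\<close>

lemma branch_use:
  assumes F: "condition b F" and g: "branch b F g" and run: "run g p x = Some v"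
  shows "\<exists>s\<in>lists {..<b}. run_fin (F s) p x = Some v"
proof -
  obtain n where n: "run_fin (g \<restriction> n) p x = Some v"
    using use_principle[OF run] by blast
  obtain s where s: "s \<in> lists {..<b}" "length s = n" "F s = g \<restriction> length (F s)"
    using g unfolding branch_def by blast
  have "n \<le> length (F s)"
    using condition_length[OF F, of "[]" s] s(2) by simp
  from run_fin_mono[OF restrict_prefix[OF this] n] s show ?thesis
    by metis
qed

section \<open>Meeting the requirements of one program\<close>

lemma force_off_tree:
  assumes F: "condition b F" and T: "tree b T" "branching k T" and k: "k < b" "1 < b"
  shows "\<exists>i<b. \<forall>g. branch b (\<lambda>s. F (i # s)) g \<longrightarrow> \<not> path_through g T"
proof -
  obtain i where i: "i < b" "F [] @ [i] \<notin> T"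
  proof (rule ccontr)
    assume "\<not> thesis"
    with that have all: "F [] @ [i] \<in> T" if "i < b" for i
      using \<open>i < b\<close> by blast
    then have "F [] \<in> T"
      using T(1) k unfolding tree_def by (metis prefixI zero_less_one less_trans)
    moreover have "{i. F [] @ [i] \<in> T} = {..<b}"
      using all T(1) unfolding tree_def by auto
    \<comment> \<open>The node would have \<open>b\<close> successors in \<open>T\<close>, but
      \<open>T\<close> allows only 1 or \<open>k\<close>, and both are less than
      \<open>b\<close>.\<close>
    ultimately show False
      using T(2) k unfolding branching_def by force
  qed
  have "\<not> path_through g T" if g: "branch b (\<lambda>s. F (i # s)) g" for g
  proof
    assume "path_through g T"
    have "prefix (F [] @ [i]) (F [i])"
      using F unfolding condition_def by (metis append_Nil)
    from prefix_restrict_eq[OF this branch_initial[OF g]]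
    have "F [] @ [i] = g \<restriction> length (F [] @ [i])" .
    with \<open>path_through g T\<close> i(2) show False
      unfolding path_through_def by metis
  qed
  with i(1) show ?thesis by blast
qed

lemma force_tame:
  assumes F: "condition b F" and b: "1 \<le> b"
  shows "\<exists>H. condition b H \<and> (\<forall>g. branch b (\<lambda>s. F (H s)) g \<longrightarrow>
      (\<forall>f. (\<forall>x. run g p x = Some (f x)) \<longrightarrow> tame b f))"
proof -
  define W where "W \<sigma> x = run_fin (F \<sigma>) p x" for \<sigma> x
  have rec_F: "recursive F"
    using F by (simp add: condition_def)
  have rec_W: "recursive (\<lambda>x. W (h x) (k x))" if "recursive h" "recursive k"
    for h and k :: "'a::coded \<Rightarrow> nat"
    unfolding W_def by (intro recursive_intros recursive_app[OF rec_F] that)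
  have mono: "W t x = Some v" if "prefix s t" "W s x = Some v" for s t x v
    using run_fin_mono[OF condition_prefix[OF F]] that unfolding W_def by blast
  \<comment> \<open>The third case joins the negations of the first two. In \<open>agree\<close>,
    convergence is not part of the case; it comes from the computation being total along
    \<open>g\<close>.\<close>
  consider
    (diverge) \<sigma> x where "\<sigma> \<in> lists {..<b}" "\<And>t. t \<in> lists {..<b} \<Longrightarrow> W (\<sigma> @ t) x = None"
  | (agree) \<sigma> where "\<sigma> \<in> lists {..<b}"
      "\<And>t t' x v v'. t \<in> lists {..<b} \<Longrightarrow> t' \<in> lists {..<b} \<Longrightarrow>
        W (\<sigma> @ t) x = Some v \<Longrightarrow> W (\<sigma> @ t') x = Some v' \<Longrightarrow> v = v'"
  | (split) "\<And>\<sigma> x. \<sigma> \<in> lists {..<b} \<Longrightarrow> \<exists>t\<in>lists {..<b}. W (\<sigma> @ t) x \<noteq> None"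
      "\<And>\<sigma>. \<sigma> \<in> lists {..<b} \<Longrightarrow> \<exists>x t t' v v'. t \<in> lists {..<b} \<and> t' \<in> lists {..<b} \<and>
        W (\<sigma> @ t) x = Some v \<and> W (\<sigma> @ t') x = Some v' \<and> v \<noteq> v'"
    by metis
  then show ?thesis
  proof cases
    case diverge
    have H: "condition b (\<lambda>s. \<sigma> @ s)"
      by (rule condition_append[OF diverge(1)])
    have "\<not> (\<forall>x. run g p x = Some (f x))" if "branch b (\<lambda>s. F (\<sigma> @ s)) g" for g f
    proof
      assume "\<forall>x. run g p x = Some (f x)"
      then have "run g p x = Some (f x)" by blast
      from branch_use[OF condition_compose[OF F H] that this] diverge(2) show False
        by (auto simp: W_def)
    qed
    with H show ?thesis by blast
  next
    case agree
    have H: "condition b (\<lambda>s. \<sigma> @ s)"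
      by (rule condition_append[OF agree(1)])
    have "computable f" if g: "branch b (\<lambda>s. F (\<sigma> @ s)) g" and f: "\<And>x. run g p x = Some (f x)" for g f
    proof -
      have val: "\<exists>t\<in>lists {..<b}. W (\<sigma> @ t) x = Some (f x)" for x
        using branch_use[OF condition_compose[OF F H] g f] by (simp add: W_def)
      \<comment> \<open>Any string above \<open>\<sigma>\<close> on which the computation converges
        gives the right value, so the search runs without access to \<open>g\<close>.\<close>
      define P where "P x t \<longleftrightarrow> (\<forall>i\<in>set t. i < b) \<and> \<not> W (\<sigma> @ t) x = None" for x t
      have ex: "\<exists>n. P x (decode n)" for x
      proof -
        obtain t where "t \<in> lists {..<b}" "W (\<sigma> @ t) x = Some (f x)" using val by blast
        then have "P x (decode (encode t))" by (auto simp: P_def)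
        then show ?thesis by blast
      qed
      define \<tau> where "\<tau> x = (decode (LEAST n. P x (decode n)) :: nat list)" for x
      have rec_decode: "recursive (\<lambda>x. decode (k x) :: nat list)" if "recursive k"
        for k :: "'a::coded \<Rightarrow> nat"
        by (rule recursive_app[OF recursive_by_code that]) (simp add: encode_simps)
      have "decidable (\<lambda>z. P (fst z) (decode (snd z)))"
        unfolding P_def by (intro recursive_intros rec_W rec_decode)
      then have rec_\<tau>: "recursive \<tau>"
        unfolding \<tau>_def by (intro rec_decode recursive_Least ex)
      have "W (\<sigma> @ \<tau> x) x = Some (f x)" for x
      proof -
        have "P x (\<tau> x)"
          unfolding \<tau>_def by (rule LeastI_ex[OF ex])
        then obtain v where "\<tau> x \<in> lists {..<b}" "W (\<sigma> @ \<tau> x) x = Some v"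
          unfolding P_def by auto
        with agree(2) val[of x] show ?thesis by metis
      qed
      then have "f x = (case W (\<sigma> @ \<tau> x) x of None \<Rightarrow> 0 | Some v \<Rightarrow> v)" for x
        by simp
      moreover have "recursive (\<lambda>x. case W (\<sigma> @ \<tau> x) x of None \<Rightarrow> 0 | Some v \<Rightarrow> v)"
        by (intro recursive_intros rec_W rec_\<tau>)
      ultimately have "recursive f" by presburger
      then show ?thesis by (simp add: recursive_nat)
    qed
    with H b show ?thesis
      by (intro exI[of _ "\<lambda>s. \<sigma> @ s"]) (blast intro: tame_if_computable)
  next
    case split
    have "\<exists>G. condition b G \<and> (\<forall>s\<in>lists {..<b}. \<exists>X>length s.
      (\<forall>i<b. \<forall>x<X. W (G (s @ [i])) x \<noteq> None) \<and>
      (\<forall>i<b. \<forall>j<b. i \<noteq> j \<longrightarrow> (\<exists>x<X. W (G (s @ [i])) x \<noteq> W (G (s @ [j])) x)))"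
      by (rule splitting_condition, intro rec_W recursive_intros, (fact mono split)+)
    then obtain G where G: "condition b G"
      and sep: "\<And>s. s \<in> lists {..<b} \<Longrightarrow> \<exists>X>length s.
        (\<forall>i<b. \<forall>x<X. W (G (s @ [i])) x \<noteq> None) \<and>
        (\<forall>i<b. \<forall>j<b. i \<noteq> j \<longrightarrow> (\<exists>x<X. W (G (s @ [i])) x \<noteq> W (G (s @ [j])) x))"
      by blast
    have "tame b f" if g: "branch b (\<lambda>s. F (G s)) g" and f: "\<And>x. run g p x = Some (f x)" for g f
    proof (rule tame_if_splitting[of "\<lambda>t. W (G t)"])
      have "recursive G"
        using G by (simp add: condition_def)
      from recursive_app[OF this recursive_fst[OF recursive_id]]
      show "recursive (\<lambda>z. W (G (fst z)) (snd z))"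
        by (intro rec_W recursive_intros)
      show "W (G t) x = Some v" if "prefix s t" "W (G s) x = Some v" for s t x v
        using mono[OF condition_prefix[OF G]] that by blast
      show "\<exists>t\<in>lists {..<b}. length t = n \<and> (\<forall>x v. W (G t) x = Some v \<longrightarrow> f x = v)" for n
      proof -
        obtain t where t: "t \<in> lists {..<b}" "length t = n" "F (G t) = g \<restriction> length (F (G t))"
          using g unfolding branch_def by blast
        have "f x = v" if "W (G t) x = Some v" for x v
        proof -
          have "run g p x = Some v"
            by (rule run_fin_sound[of g "length (F (G t))"]) (use t(3) that in \<open>simp add: W_def\<close>)
          with f show ?thesis by simp
        qed
        with t show ?thesis by blast
      qed
    qed (fact sep b)+
    with G show ?thesis by blast
  qed
qed

section \<open>Construction of the generic path\<close>

text \<open>Countability lets \<open>from_nat\<close> run through all programs, one at each stage of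
  the construction.\<close>

instance prog :: countable
  by countable_datatype

lemma exists_generic:
  assumes k: "k \<ge> 2"
  shows "\<exists>g. surviving k g \<and> (\<forall>f. f \<le>\<^sub>T g \<longrightarrow> tame (k + 1) f)"
proof -
  define b where "b = k + 1"
  \<comment> \<open>Every computable set of strings is \<open>T p\<close> for some \<open>p\<close>.
    A partial \<open>p\<close> also gives a set, so the requirement makes sense for every
    program.\<close>
  define T where "T p = {s. run (\<lambda>_. 0) p (list_encode s) = Some 1}" for p
  define meets where "meets p g \<longleftrightarrow> (tree b (T p) \<and> branching k (T p) \<longrightarrow> \<not> path_through g (T p)) \<and>
      (\<forall>f. (\<forall>x. run g p x = Some (f x)) \<longrightarrow> tame b f)" for p g
  \<comment> \<open>\<open>H [] \<noteq> []\<close> makes each stage lengthen the stem, so that the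
    stems determine a total function in the limit.\<close>
  have step: "\<exists>H. condition b H \<and> H [] \<noteq> [] \<and> (\<forall>g. branch b (\<lambda>s. F (H s)) g \<longrightarrow> meets p g)"
    if F: "condition b F" for F p
  proof -
    obtain i where i: "i < b" "\<And>g. branch b (\<lambda>s. F (i # s)) g \<Longrightarrow>
        tree b (T p) \<and> branching k (T p) \<longrightarrow> \<not> path_through g (T p)"
      using force_off_tree[OF F, of "T p" k] k b_def by (cases "tree b (T p) \<and> branching k (T p)") auto
    have I: "condition b (\<lambda>s. i # s)"
      using condition_append[of "[i]" b] i(1) by simp
    obtain H where H: "condition b H" "\<And>g f. branch b (\<lambda>s. F (i # H s)) g \<Longrightarrow>
        (\<forall>x. run g p x = Some (f x)) \<Longrightarrow> tame b f"
      using force_tame[OF condition_compose[OF F I], of p] k by (auto simp: b_def)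
    have "meets p g" if "branch b (\<lambda>s. F (i # H s)) g" for g
      using i(2)[OF branch_refine[OF condition_compose[OF F I] H(1) that]] H(2)[OF that]
      unfolding meets_def by blast
    then show ?thesis
      using condition_compose[OF I H(1)] by (intro exI[of _ "\<lambda>s. i # H s"]) simp
  qed
  have "\<exists>Fs. \<forall>n. condition b (Fs n) \<and> (\<exists>H. condition b H \<and> H [] \<noteq> [] \<and>
      Fs (Suc n) = (\<lambda>s. Fs n (H s)) \<and> (\<forall>g. branch b (Fs (Suc n)) g \<longrightarrow> meets (from_nat n) g))"
  proof (rule dependent_nat_choice)
    show "\<exists>F. condition b F"
      using condition_id by blast
    show "\<exists>F'. condition b F' \<and> (\<exists>H. condition b H \<and> H [] \<noteq> [] \<and>
      F' = (\<lambda>s. F (H s)) \<and> (\<forall>g. branch b F' g \<longrightarrow> meets (from_nat n) g))"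
      if "condition b F" for F n
      using step[OF that, of "from_nat n"] condition_compose[OF that] by blast
  qed
  then obtain Fs H where Fs: "\<And>n. condition b (Fs n)" and H: "\<And>n. condition b (H n)" "\<And>n. H n [] \<noteq> []"
    and Suc: "\<And>n. Fs (Suc n) = (\<lambda>s. Fs n (H n s))"
    and meets: "\<And>n g. branch b (Fs (Suc n)) g \<Longrightarrow> meets (from_nat n) g"
    by metis
  \<comment> \<open>The bound on \<open>K []\<close> says that \<open>m\<close> further stages fix
    at least \<open>m\<close> turns in the tree of \<open>Fs n\<close>; this later shows that the
    limit is a path through every stage.\<close>
  have tail: "\<exists>K. condition b K \<and> Fs (n + m) = (\<lambda>s. Fs n (K s)) \<and> m \<le> length (K [])" for n m
  proof (induction m)
    case 0
    show ?case by (intro exI[of _ "\<lambda>s. s"]) (simp add: condition_id)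
  next
    case (Suc m)
    then obtain K where K: "condition b K" "Fs (n + m) = (\<lambda>s. Fs n (K s))" "m \<le> length (K [])"
      by blast
    have "length (K []) + length (H (n + m) []) \<le> length (K (H (n + m) []))"
      using condition_length[OF K(1), of "[]"] by simp
    moreover have "length (H (n + m) []) > 0"
      using H(2) by simp
    ultimately have "Suc m \<le> length (K (H (n + m) []))"
      using K(3) by linarith
    then show ?case
      using condition_compose[OF K(1) H(1)[of "n + m"]] K(2) \<open>\<And>n. Fs (Suc n) = (\<lambda>s. Fs n (H n s))\<close>
      by (intro exI[of _ "\<lambda>s. K (H (n + m) s)"]) simp
  qed
  have pre: "prefix (Fs m []) (Fs n [])" if "m \<le> n" for m n
    using tail[of m "n - m"] that condition_prefix[OF Fs] by fastforce
  have len: "n \<le> length (Fs n [])" for n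
  proof -
    obtain K where "Fs (0 + n) = (\<lambda>s. Fs 0 (K s))" "n \<le> length (K [])"
      using tail by blast
    then show ?thesis
      using condition_length[OF Fs, of 0 "[]" "K []"] by simp
  qed
  \<comment> \<open>The stem at stage \<open>j + 1\<close> has length at least \<open>j + 1\<close>,
    so its entry \<open>j\<close> exists.\<close>
  define g where "g j = Fs (Suc j) [] ! j" for j
  have initial: "Fs n [] = g \<restriction> length (Fs n [])" for n
  proof (rule nth_equalityI)
    fix j assume j: "j < length (Fs n [])"
    have "Fs n [] ! j = Fs (Suc j) [] ! j"
      using pre[of n "Suc j"] pre[of "Suc j" n] j len[of "Suc j"]
      by (cases "n \<le> Suc j") (auto simp: prefix_def nth_append)
    then show "Fs n [] ! j = (g \<restriction> length (Fs n [])) ! j"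
      using j by (simp add: g_def)
  qed simp
  have branch: "branch b (Fs n) g" for n
    unfolding branch_def
  proof
    fix m
    obtain K where K: "condition b K" "Fs (n + m) = (\<lambda>s. Fs n (K s))" "m \<le> length (K [])"
      using tail by blast
    have "take m (K []) \<in> lists {..<b}"
      using K(1) unfolding condition_def by (meson in_listsD in_listsI in_set_takeD lists.Nil)
    moreover have "Fs n (K []) = g \<restriction> length (Fs n (K []))"
      using initial[of "n + m"] K(2) by simp
    then have "Fs n (take m (K [])) = g \<restriction> length (Fs n (take m (K [])))"
      by (rule prefix_restrict_eq[OF condition_prefix[OF Fs take_is_prefix]])
    ultimately show "\<exists>s\<in>lists {..<b}. length s = m \<and> Fs n s = g \<restriction> length (Fs n s)"
      using K(3) by (intro bexI[of _ "take m (K [])"]) auto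
  qed
  \<comment> \<open>The requirement of \<open>p\<close> is treated in the step from
    \<open>to_nat p\<close> to its successor, and \<open>g\<close> is a path through the resulting
    condition.\<close>
  have meets_g: "meets p g" for p
    using meets[OF branch[of "Suc (to_nat p)"]] by simp
  have "surviving k g"
    unfolding surviving_def
  proof (intro conjI allI notI)
    fix n
    have "Fs (Suc n) [] \<in> lists {..<b}"
      using Fs[of "Suc n"] by (simp add: condition_def)
    moreover have "n < length (Fs (Suc n) [])"
      using len[of "Suc n"] by simp
    ultimately show "g n < k + 1"
      unfolding g_def b_def by (metis in_listsD lessThan_iff nth_mem)
  next
    assume "\<exists>S. tree (k + 1) S \<and> branching k S \<and> computable_strings S \<and> path_through g S"
    then obtain S p where S: "tree b S" "branching k S" "path_through g S"
      and p: "\<And>x. run (\<lambda>_. 0) p x = Some (if list_decode x \<in> S then 1 else 0)"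
      unfolding computable_strings_def computable_def turing_le_def b_def by blast
    have "T p = S"
      by (auto simp: T_def p)
    with S meets_g[of p] show False
      unfolding meets_def by blast
  qed
  moreover have "tame (k + 1) f" if "f \<le>\<^sub>T g" for f
    using that meets_g unfolding turing_le_def meets_def b_def by blast
  ultimately show ?thesis by blast
qed

theorem theorem2p10:
  fixes k :: nat
  assumes "k \<ge> 2"
  shows "\<exists>a :: turing_degree.
           surviving_degree k a \<and> (\<forall>l\<ge>k + 1. \<not> surviving_degree l a) \<and> computably_traceable a"
proof -
  obtain g where g: "surviving k g" "\<And>f. f \<le>\<^sub>T g \<Longrightarrow> tame (k + 1) f"
    using exists_generic[OF assms] by blast
  define a where "a = abs_turing_degree g"
  have a: "computes a f \<longleftrightarrow> f \<le>\<^sub>T g" for f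
    by (simp add: a_def computes.abs_eq)
  have "recursive (\<lambda>n. (k + 1) ^ Suc n)"
    by (intro recursive_intros)
  then have "computable (\<lambda>n. (k + 1) ^ Suc n)"
    by (simp only: recursive_nat)
  then have "computably_traceable a"
    unfolding computably_traceable_def a
    using g(2) unfolding tame_def by (intro exI[of _ "\<lambda>n. (k + 1) ^ Suc n"]) blast
  moreover have "surviving_degree k a"
    using g(1) turing_le_refl a unfolding surviving_degree_def by blast
  moreover have "\<not> surviving_degree l a" if "l \<ge> k + 1" for l
    using g(2) that a unfolding surviving_degree_def tame_def by blast
  ultimately show ?thesis by blast
qed

end
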